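(* Let $m,n\in\mathbb N$, let $A_0$ and $B_l$ ($0\le |l|\le m$) be complex $n\times n$ matrices and let $d_l\in\mathbb C^n$ ($0\le|l|\le m$). Consider, with a large parameter $\omega>0$, the system $$\frac{dx}{dt}=\Big(A_0+\frac1\omega B_0\Big)x+\sum_{1\le |l|\le m}(B_lx+d_l)e^{il\omega t}+d_0. \qquad ( * )$$ Suppose that $\lambda=0$ is an eigenvalue of $A_0$, let $a_1,\dots,a_s$ ($1\le s\le n$) be a basis of $\ker A_0$, put $$A_1=B_0+\sum_{1\le|l|\le m}\frac{B_{-l}B_l}{il},$$ and suppose that for every $(\mu_1,\dots,\mu_s)\in\mathbb C^s\setminus\{0\}$ the equation $A_0x+A_1(\mu_1a_1+\dots+\mu_sa_s)=0$ has no solution $x\in\mathbb C^n$. Then for all sufficiently large $\omega$ the system $( * )$ has a unique $\frac{2\pi}{\omega}$-periodic solution $x(t)$, and it is represented by a series converging absolutely and uniformly on the axis $t\in\mathbb R$, $$x(t)=\omega\sum_{j=1}^sC_{-1}^ja_j+\sum_{k=0}^\infty\frac1{\omega^k}\Big(x_k+y_k(\omega t)+\sum_{j=1}^sC_k^ja_j\Big),$$ where $C_{-1}^j,C_k^j\in\mathbb C$, $x_k\in\mathbb C^n$ and $y_k:\mathbb R\to\mathbb C^n$ are $2\pi$-periodic vector functions with zero mean ($j=1,\dots,s$, $k=0,1,2,\dots$), all independent of $\omega$, and effectively determined (finding each of them reduces to finitely many arithmetic operations on known numbers and functions). Moreover there is a constant $M_0$ such that for all sufficiently large $\omega$, all $t\in\mathbb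 R$ and all $r=0,1,2,\dots$ $$\Big|x(t)-\omega\sum_{j=1}^sC_{-1}^ja_j-\sum_{k=0}^r\frac1{\omega^k}\Big(x_k+y_k(\omega t)+\sum_{j=1}^sC_k^ja_j\Big)\Big|\le\frac{M_0^{r+1}}{\omega^{r+1}}.$$
   Context: The index $l$ runs over integers. The mean of a continuous $T$-periodic vector function $a(\tau)$ is $\langle a\rangle=\frac1T\int_0^Ta(\tau)\,d\tau$ (componentwise). $|\cdot|$ is the Euclidean norm on $\mathbb C^n$. *)

theory Defs
  imports "HOL-Analysis.Analysis"
begin

definition is_eigenvalue :: "complex ^ 'n ^ 'n \<Rightarrow> complex \<Rightarrow> bool" where
  "is_eigenvalue A z \<longleftrightarrow> (\<exists>v. v \<noteq> 0 \<and> A *v v = z *s v)"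

text \<open>Linear (in)dependence and span are over the complex numbers, i.e. with respect to \<open>*s\<close>.\<close>
definition is_kernel_basis :: "nat \<Rightarrow> (nat \<Rightarrow> complex ^ 'n) \<Rightarrow> complex ^ 'n ^ 'n \<Rightarrow> bool" where
  "is_kernel_basis s a A \<longleftrightarrow>
     inj_on a {1..s} \<and> vec.independent (a ` {1..s}) \<and> vec.span (a ` {1..s}) = {v. A *v v = 0}"

definition mean :: "real \<Rightarrow> (real \<Rightarrow> complex ^ 'n) \<Rightarrow> complex ^ 'n" where
  "mean T f = (1 / T) *\<^sub>R integral {0..T} f"

definition osc_indices :: "nat \<Rightarrow> int set" where
  "osc_indices m = {l. 1 \<le> \<bar>l\<bar> \<and> \<bar>l\<bar> \<le> int m}"

definition osc_rhs ::
  "nat \<Rightarrow> complex ^ 'n ^ 'n \<Rightarrow> (int \<Rightarrow> complex ^ 'n ^ 'n) \<Rightarrow> (int \<Rightarrow> complex ^ 'n)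
    \<Rightarrow> real \<Rightarrow> real \<Rightarrow> complex ^ 'n \<Rightarrow> complex ^ 'n" where
  "osc_rhs m A0 B d \<omega> t v =
     (A0 + (1 / \<omega>) *\<^sub>R B 0) *v v
     + (\<Sum>l\<in>osc_indices m. exp (\<i> * of_int l * of_real \<omega> * of_real t) *s (B l *v v + d l))
     + d 0"

definition is_periodic_solution ::
  "nat \<Rightarrow> complex ^ 'n ^ 'n \<Rightarrow> (int \<Rightarrow> complex ^ 'n ^ 'n) \<Rightarrow> (int \<Rightarrow> complex ^ 'n)
    \<Rightarrow> real \<Rightarrow> (real \<Rightarrow> complex ^ 'n) \<Rightarrow> bool" where
  "is_periodic_solution m A0 B d \<omega> x \<longleftrightarrow>
     (\<forall>t. (x has_vector_derivative osc_rhs m A0 B d \<omega> t (x t)) (at t)) \<and>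
     (\<forall>t. x (t + 2 * pi / \<omega>) = x t)"

definition averaged_A1 :: "nat \<Rightarrow> (int \<Rightarrow> complex ^ 'n ^ 'n) \<Rightarrow> complex ^ 'n ^ 'n" where
  "averaged_A1 m B =
     B 0 + (\<Sum>l\<in>osc_indices m. \<chi> p q. (B (- l) ** B l) $ p $ q / (\<i> * of_int l))"

definition series_term ::
  "nat \<Rightarrow> (nat \<Rightarrow> complex ^ 'n) \<Rightarrow> (nat \<Rightarrow> nat \<Rightarrow> complex) \<Rightarrow> (nat \<Rightarrow> complex ^ 'n)
    \<Rightarrow> (nat \<Rightarrow> real \<Rightarrow> complex ^ 'n) \<Rightarrow> real \<Rightarrow> nat \<Rightarrow> real \<Rightarrow> complex ^ 'n" where
  "series_term s a C x y \<omega> k t =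
     (1 / \<omega> ^ k) *\<^sub>R (x k + y k (\<omega> * t) + (\<Sum>j=1..s. C k j *s a j))"

text \<open>
  Effective determination.  The problem data are the tuple \<open>(A0, B, d, a)\<close>.  A quantity is
  effectively determined if one finite procedure, the same for all data with given
  \<open>m\<close>, \<open>s\<close> and \<open>n\<close>, computes it from the entries of the data by arithmetic operations and
  zero tests (the latter as in the choice of pivots when solving a linear system).  Such procedures
  are represented by the maps from data to values that they compute.  As always in HOL, division
  by zero yields zero; this adds nothing, since zero tests are available.  The procedures can read
  only \<open>B l\<close>, \<open>d l\<close> with \<open>\<bar>l\<bar> \<le> m\<close> and \<open>a j\<close> with \<open>1 \<le> j \<le> s\<close>.
\<close>

type_synonym 'n data =
  "(complex ^ 'n ^ 'n) \<times> (int \<Rightarrow> complex ^ 'n ^ 'n) \<times> (int \<Rightarrow> complex ^ 'n) \<times> (nat \<Rightarrow> complex ^ 'n)"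

inductive_set arith_num :: "nat \<Rightarrow> nat \<Rightarrow> (('n::finite) data \<Rightarrow> complex) set" for m s :: nat where
  entry_A0: "(\<lambda>(A0, B, d, a). A0 $ p $ q) \<in> arith_num m s"
| entry_B: "\<bar>l\<bar> \<le> int m \<Longrightarrow> (\<lambda>(A0, B, d, a). B l $ p $ q) \<in> arith_num m s"
| entry_d: "\<bar>l\<bar> \<le> int m \<Longrightarrow> (\<lambda>(A0, B, d, a). d l $ p) \<in> arith_num m s"
| entry_a: "j \<in> {1..s} \<Longrightarrow> (\<lambda>(A0, B, d, a). a j $ p) \<in> arith_num m s"
| one: "(\<lambda>D. 1) \<in> arith_num m s"
| imag_unit: "(\<lambda>D. \<i>) \<in> arith_num m s"
| add: "f \<in> arith_num m s \<Longrightarrow> g \<in> arith_num m s \<Longrightarrow> (\<lambda>D. f D + g D) \<in> arith_num m s"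
| diff: "f \<in> arith_num m s \<Longrightarrow> g \<in> arith_num m s \<Longrightarrow> (\<lambda>D. f D - g D) \<in> arith_num m s"
| mult: "f \<in> arith_num m s \<Longrightarrow> g \<in> arith_num m s \<Longrightarrow> (\<lambda>D. f D * g D) \<in> arith_num m s"
| divide: "f \<in> arith_num m s \<Longrightarrow> g \<in> arith_num m s \<Longrightarrow> (\<lambda>D. f D / g D) \<in> arith_num m s"
| zero_test: "f \<in> arith_num m s \<Longrightarrow> g \<in> arith_num m s \<Longrightarrow> h \<in> arith_num m s \<Longrightarrow>
    (\<lambda>D. if f D = 0 then g D else h D) \<in> arith_num m s"

text \<open>For functions of \<open>\<tau>\<close>, the known functions are the exponentials occurring in the system.\<close>

inductive_set arith_fun :: "nat \<Rightarrow> nat \<Rightarrow> (('n::finite) data \<Rightarrow> real \<Rightarrow> complex) set" for m s :: nat where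
  const: "f \<in> arith_num m s \<Longrightarrow> (\<lambda>D \<tau>. f D) \<in> arith_fun m s"
| expo: "l \<in> osc_indices m \<Longrightarrow> (\<lambda>D \<tau>. exp (\<i> * of_int l * of_real \<tau>)) \<in> arith_fun m s"
| add: "f \<in> arith_fun m s \<Longrightarrow> g \<in> arith_fun m s \<Longrightarrow> (\<lambda>D \<tau>. f D \<tau> + g D \<tau>) \<in> arith_fun m s"
| diff: "f \<in> arith_fun m s \<Longrightarrow> g \<in> arith_fun m s \<Longrightarrow> (\<lambda>D \<tau>. f D \<tau> - g D \<tau>) \<in> arith_fun m s"
| mult: "f \<in> arith_fun m s \<Longrightarrow> g \<in> arith_fun m s \<Longrightarrow> (\<lambda>D \<tau>. f D \<tau> * g D \<tau>) \<in> arith_fun m s"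

end

theory Submission
  imports Defs
begin

text \<open>Put \<open>\<epsilon> = 1/\<omega>\<close> and \<open>\<tau> = \<omega>t\<close>, and look for the periodic solution as \<open>x = \<omega> \<Sum>k. \<epsilon>^k w\<^sub>k(\<tau>)\<close> with
\<open>2\<pi>\<close>-periodic \<open>w\<^sub>k\<close>.  With \<open>S(\<tau>) = \<Sum>l\<noteq>0. e^(il\<tau>) B\<^sub>l\<close> and the forcing
\<open>d(\<tau>) = \<Sum>l. e^(il\<tau>) d\<^sub>l\<close>, comparing powers of \<open>\<epsilon>\<close> gives
\<open>w\<^sub>0' = 0\<close> and \<open>w\<^sub>k\<^sub>+\<^sub>1' = A\<^sub>0 w\<^sub>k + S w\<^sub>k + B\<^sub>0 w\<^sub>k\<^sub>-\<^sub>1\<close>, with \<open>d\<close> added for \<open>k = 1\<close>.  The term of order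
\<open>\<omega>^(-k)\<close> in the theorem is therefore \<open>w\<^sub>k\<^sub>+\<^sub>1\<close>, and \<open>w\<^sub>0\<close> is the coefficient of \<open>\<omega>\<close>.

Split \<open>w\<^sub>k = c\<^sub>k + y\<^sub>k\<close> into its mean and a trigonometric polynomial of mean zero.  The nonzero
frequencies of the equation determine \<open>y\<^sub>k\<^sub>+\<^sub>1\<close>: divide the Fourier coefficients of the right-hand
side by \<open>il\<close>.  The mean value of the right-hand side must vanish; inserting the contribution of
\<open>c\<^sub>k\<close> to \<open>y\<^sub>k\<^sub>+\<^sub>1\<close>, namely \<open>\<Sum>l. e^(il\<tau>) B\<^sub>l c\<^sub>k / (il)\<close>, turns this solvability condition into
\<open>A\<^sub>0 c\<^sub>k\<^sub>+\<^sub>1 + A\<^sub>1 c\<^sub>k = \<close> known terms, which is where the averaged matrix \<open>A\<^sub>1\<close> comes from.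
Writing \<open>c\<^sub>k = p\<^sub>k + q\<^sub>k\<close> with \<open>q\<^sub>k\<close> in the kernel of \<open>A\<^sub>0\<close>, one step has to solve
\<open>A\<^sub>0 p\<^sub>k\<^sub>+\<^sub>1 + A\<^sub>1 q\<^sub>k = f\<^sub>k\<close> for the pair of unknowns.  The hypothesis on \<open>A\<^sub>1\<close> says that
\<open>A\<^sub>1\<close> is injective on \<open>ker A\<^sub>0\<close> and that the image misses the range of \<open>A\<^sub>0\<close>, so by counting dimensions every
right-hand side is attained (\<open>averaged_system_surjective\<close>).  Gaussian elimination then yields a linear
right inverse \<open>f \<mapsto> (p, q)\<close> whose entries are arithmetic in the data (\<open>arith_solve\<close>,
\<open>right_inverse_procedure_exists\<close>), and so are all coefficients produced by the recursion.

The step \<open>k \<rightarrow> k + 1\<close> is a bounded affine map independent of \<open>k\<close> but for the inhomogeneities in the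
first two steps, hence all coefficients are \<open>O(R^k)\<close> (\<open>coefficients_geometric\<close>); \<open>y\<^sub>k\<close> has \<open>O(k)\<close>
frequencies, so \<open>w\<^sub>k\<close> and \<open>w\<^sub>k'\<close> are bounded geometrically in the sup norm.  For large \<open>\<omega>\<close> the series
may be differentiated term by term, solves the system (\<open>solution_is_periodic_solution\<close>), and has
geometric remainders (\<open>geometric_tail\<close>).

For uniqueness, let \<open>v\<close> be a periodic solution of the homogeneous system.  Its Fourier coefficients
obey the same relations; they show first that the nonzero frequencies are \<open>O(\<epsilon>)\<close> relative to
the mean \<open>c\<close>, then that \<open>A\<^sub>0 c + \<epsilon> A\<^sub>1 c = O(\<epsilon>\<^sup>2) |c|\<close>, whereas the right inverse gives
\<open>|c| \<le> O(\<omega>) |A\<^sub>0 c + \<epsilon> A\<^sub>1 c|\<close> (\<open>averaged_matrix_bound\<close>).  So \<open>c = 0\<close> (\<open>fourier_mean_zero\<close>), and a function of mean zero whose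
derivative is bounded by a constant multiple of its own maximum vanishes once the period is short
(\<open>zero_mean_bound\<close>).\<close>

section \<open>Quantities that are arithmetic in the data\<close>

lemma arith_zero: "(\<lambda>D. 0) \<in> arith_num m s"
  using arith_num.diff[OF arith_num.one arith_num.one] by simp

lemma arith_uminus: "f \<in> arith_num m s \<Longrightarrow> (\<lambda>D. - f D) \<in> arith_num m s"
  using arith_num.diff[OF arith_zero] by simp

lemma arith_of_nat: "(\<lambda>D. of_nat k) \<in> arith_num m s"
  by (induction k) (auto simp: add.commute intro: arith_zero arith_num.add arith_num.one)

lemma arith_of_int: "(\<lambda>D. of_int l) \<in> arith_num m s"
  by (cases l rule: int_cases2) (auto intro: arith_of_nat arith_uminus)

lemma arith_sum:
  assumes "\<And>i. i \<in> I \<Longrightarrow> f i \<in> arith_num m s"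
  shows "(\<lambda>D. \<Sum>i\<in>I. f i D) \<in> arith_num m s"
  using assms
proof (induction I rule: infinite_finite_induct)
  case (insert i I)
  then show ?case by (auto intro: arith_num.add)
qed (auto intro: arith_zero)

abbreviation data_A0 :: "'n data \<Rightarrow> complex ^ 'n ^ 'n" where "data_A0 D \<equiv> fst D"
abbreviation data_B :: "'n data \<Rightarrow> int \<Rightarrow> complex ^ 'n ^ 'n" where "data_B D \<equiv> fst (snd D)"
abbreviation data_d :: "'n data \<Rightarrow> int \<Rightarrow> complex ^ 'n" where "data_d D \<equiv> fst (snd (snd D))"
abbreviation data_a :: "'n data \<Rightarrow> nat \<Rightarrow> complex ^ 'n" where "data_a D \<equiv> snd (snd (snd D))"

definition arith_vec :: "nat \<Rightarrow> nat \<Rightarrow> (('n::finite) data \<Rightarrow> complex ^ 'n) \<Rightarrow> bool" where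
  "arith_vec m s v \<longleftrightarrow> (\<forall>p. (\<lambda>D. v D $ p) \<in> arith_num m s)"

definition arith_mat :: "nat \<Rightarrow> nat \<Rightarrow> (('n::finite) data \<Rightarrow> complex ^ 'n ^ 'n) \<Rightarrow> bool" where
  "arith_mat m s M \<longleftrightarrow> (\<forall>p q. (\<lambda>D. M D $ p $ q) \<in> arith_num m s)"

lemma arith_mat_A0: "arith_mat m s data_A0"
  using arith_num.entry_A0 by (auto simp: arith_mat_def split_def)

lemma arith_mat_B: "\<bar>l\<bar> \<le> int m \<Longrightarrow> arith_mat m s (\<lambda>D. data_B D l)"
  using arith_num.entry_B by (auto simp: arith_mat_def split_def)

lemma arith_vec_d: "\<bar>l\<bar> \<le> int m \<Longrightarrow> arith_vec m s (\<lambda>D. data_d D l)"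
  using arith_num.entry_d by (auto simp: arith_vec_def split_def)

lemma arith_vec_a: "j \<in> {1..s} \<Longrightarrow> arith_vec m s (\<lambda>D. data_a D j)"
  using arith_num.entry_a by (auto simp: arith_vec_def split_def)

lemma arith_vec_zero: "arith_vec m s (\<lambda>D. 0)"
  by (simp add: arith_vec_def arith_zero)

lemma arith_vec_add: "arith_vec m s u \<Longrightarrow> arith_vec m s v \<Longrightarrow> arith_vec m s (\<lambda>D. u D + v D)"
  by (simp add: arith_vec_def arith_num.add)

lemma arith_vec_diff: "arith_vec m s u \<Longrightarrow> arith_vec m s v \<Longrightarrow> arith_vec m s (\<lambda>D. u D - v D)"
  by (simp add: arith_vec_def arith_num.diff)

lemma arith_vec_scale:
  "f \<in> arith_num m s \<Longrightarrow> arith_vec m s v \<Longrightarrow> arith_vec m s (\<lambda>D. f D *s v D)"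
  by (simp add: arith_vec_def arith_num.mult)

lemma arith_vec_sum:
  "(\<And>i. i \<in> I \<Longrightarrow> arith_vec m s (v i)) \<Longrightarrow> arith_vec m s (\<lambda>D. \<Sum>i\<in>I. v i D)"
  by (simp add: arith_vec_def arith_sum)

lemma arith_vec_mult:
  "arith_mat m s M \<Longrightarrow> arith_vec m s v \<Longrightarrow> arith_vec m s (\<lambda>D. M D *v v D)"
  by (simp add: arith_vec_def arith_mat_def matrix_vector_mult_def arith_sum arith_num.mult)

lemma arith_mat_averaged: "arith_mat m s (\<lambda>D :: ('n::finite) data. averaged_A1 m (data_B D))"
proof -
  have B: "(\<lambda>D :: 'n data. data_B D l $ p $ q) \<in> arith_num m s" if "\<bar>l\<bar> \<le> int m" for l p q
    using arith_mat_B[OF that, where s = s and 'a = 'n] by (simp add: arith_mat_def)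
  show ?thesis
    unfolding arith_mat_def averaged_A1_def matrix_matrix_mult_def
    by (auto simp: osc_indices_def intro!: arith_num.intros arith_sum arith_of_int B)
qed

text \<open>Pivot search: finitely many zero tests merge the procedures \<open>lam i\<close>, each meant for data with
  \<open>t i \<noteq> 0\<close>, into a single one that works for all data, \<open>lam0\<close> serving the case without a pivot.\<close>

lemma arith_select:
  fixes lam :: "'i \<Rightarrow> 'k \<Rightarrow> ('n::finite) data \<Rightarrow> complex"
  assumes "finite I"
    and "\<And>i. i \<in> I \<Longrightarrow> t i \<in> arith_num m s"
    and "\<And>i k. i \<in> I \<Longrightarrow> k \<in> K \<Longrightarrow> lam i k \<in> arith_num m s"
    and "\<And>k. k \<in> K \<Longrightarrow> lam0 k \<in> arith_num m s"
  shows "\<exists>\<mu>. (\<forall>k\<in>K. \<mu> k \<in> arith_num m s) \<and>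
    (\<forall>D. (\<exists>i\<in>I. t i D \<noteq> 0 \<and> (\<forall>k. \<mu> k D = lam i k D)) \<or>
         ((\<forall>i\<in>I. t i D = 0) \<and> (\<forall>k. \<mu> k D = lam0 k D)))"
  using assms
proof (induction I rule: finite_induct)
  case empty
  then show ?case by auto
next
  case (insert i I)
  then obtain \<mu> where \<mu>: "\<forall>k\<in>K. \<mu> k \<in> arith_num m s"
    "\<forall>D. (\<exists>i\<in>I. t i D \<noteq> 0 \<and> (\<forall>k. \<mu> k D = lam i k D)) \<or>
         ((\<forall>i\<in>I. t i D = 0) \<and> (\<forall>k. \<mu> k D = lam0 k D))"
    by blast
  let ?\<nu> = "\<lambda>k D. if t i D = 0 then \<mu> k D else lam i k D"
  have "\<forall>k\<in>K. ?\<nu> k \<in> arith_num m s"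
    using \<mu>(1) insert.prems by (auto intro: arith_num.zero_test)
  moreover have "(\<exists>i\<in>insert i I. t i D \<noteq> 0 \<and> (\<forall>k. ?\<nu> k D = lam i k D)) \<or>
         ((\<forall>i\<in>insert i I. t i D = 0) \<and> (\<forall>k. ?\<nu> k D = lam0 k D))" for D
    using \<mu>(2)[rule_format, of D] by (cases "t i D = 0") auto
  ultimately show ?case by (intro exI[of _ ?\<nu>]) simp
qed

text \<open>Gaussian elimination, by induction on the number of columns.  Subtracting multiples of the column
  \<open>f i0\<close> clears the pivot entry \<open>p\<close> in \<open>g\<close> and in all other columns; the induction hypothesis solves
  the reduced system, and the coefficient of \<open>f i0\<close> is recovered from the entry \<open>p\<close>.  If
  \<open>f i0\<close> vanishes, it is dropped.\<close>

lemma arith_solve: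
  fixes f :: "'i \<Rightarrow> ('n::finite) data \<Rightarrow> complex ^ 'n"
  assumes "finite I" "\<And>i. i \<in> I \<Longrightarrow> arith_vec m s (f i)" "arith_vec m s g"
  shows "\<exists>lam. (\<forall>i\<in>I. lam i \<in> arith_num m s) \<and>
    (\<forall>D. (\<exists>\<mu>. g D = (\<Sum>i\<in>I. \<mu> i *s f i D)) \<longrightarrow> g D = (\<Sum>i\<in>I. lam i D *s f i D))"
  using assms
proof (induction I arbitrary: f g rule: finite_induct)
  case empty
  then show ?case by auto
next
  case (insert i0 I)
  let ?red = "\<lambda>p v D. v D - (v D $ p / f i0 D $ p) *s f i0 D"
  have comp: "(\<lambda>D. v D $ p) \<in> arith_num m s" if "arith_vec m s v"
    for p and v :: "'n data \<Rightarrow> complex ^ 'n"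
    using that by (simp add: arith_vec_def)
  have fI: "arith_vec m s (f i)" if "i \<in> insert i0 I" for i
    using that insert.prems by blast
  have red: "arith_vec m s (?red p v)" if "arith_vec m s v" for p and v :: "'n data \<Rightarrow> complex ^ 'n"
    using that fI by (intro arith_vec_diff arith_vec_scale arith_num.divide comp) auto
  define solves where "solves = (\<lambda>(f :: 'i \<Rightarrow> 'n data \<Rightarrow> complex ^ 'n) g lam.
    (\<forall>i\<in>I. lam i \<in> arith_num m s) \<and>
    (\<forall>D. (\<exists>\<mu>. g D = (\<Sum>i\<in>I. \<mu> i *s f i D)) \<longrightarrow> g D = (\<Sum>i\<in>I. lam i D *s f i D)))"
  have IH: "\<exists>lam. solves f' g' lam"
    if "\<And>i. i \<in> I \<Longrightarrow> arith_vec m s (f' i)" "arith_vec m s g'" for f' g'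
    using insert.IH[OF that] by (simp add: solves_def)
  have "\<forall>p. \<exists>lam. solves (\<lambda>i. ?red p (f i)) (?red p g) lam"
    by (intro allI IH red fI insert.prems(2)) auto
  from choice[OF this] obtain lam
    where "\<And>p. solves (\<lambda>i. ?red p (f i)) (?red p g) (lam p)" by blast
  then have lam: "\<And>p i. i \<in> I \<Longrightarrow> lam p i \<in> arith_num m s"
    "\<And>p D \<mu>. ?red p g D = (\<Sum>i\<in>I. \<mu> i *s ?red p (f i) D)
       \<Longrightarrow> ?red p g D = (\<Sum>i\<in>I. lam p i D *s ?red p (f i) D)"
    unfolding solves_def by blast+
  obtain lam0 where "solves f g lam0" using IH[of f g] fI insert.prems(2) by blast
  then have lam0: "\<And>i. i \<in> I \<Longrightarrow> lam0 i \<in> arith_num m s"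
    "\<And>D \<mu>. g D = (\<Sum>i\<in>I. \<mu> i *s f i D) \<Longrightarrow> g D = (\<Sum>i\<in>I. lam0 i D *s f i D)"
    unfolding solves_def by blast+
  \<comment> \<open>back substitution for the pivot entry \<open>p\<close>, and the extension by zero when there is no pivot\<close>
  define ext where "ext = (\<lambda>p i D. if i = i0
      then g D $ p / f i0 D $ p - (\<Sum>i\<in>I. lam p i D * (f i D $ p / f i0 D $ p)) else lam p i D)"
  define ext0 where "ext0 = (\<lambda>i D. if i = i0 then 0 else lam0 i D)"
  have ext: "ext p i \<in> arith_num m s" if "i \<in> insert i0 I" for p i
    using that insert.prems(2) fI lam(1)
    by (cases "i = i0") (auto simp: ext_def
        intro!: arith_num.diff arith_num.divide arith_num.mult arith_sum comp)
  have ext0: "ext0 i \<in> arith_num m s" if "i \<in> insert i0 I" for i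
    using that lam0(1) by (cases "i = i0") (auto simp: ext0_def arith_zero)
  obtain \<mu> where \<mu>: "\<forall>k\<in>insert i0 I. \<mu> k \<in> arith_num m s"
    "\<And>D. (\<exists>p\<in>UNIV. f i0 D $ p \<noteq> 0 \<and> (\<forall>k. \<mu> k D = ext p k D)) \<or>
         ((\<forall>p\<in>UNIV. f i0 D $ p = 0) \<and> (\<forall>k. \<mu> k D = ext0 k D))"
    using arith_select[of "UNIV :: 'n set" "\<lambda>p D. f i0 D $ p" m s "insert i0 I" ext ext0]
      ext ext0 fI comp by auto
  have "g D = (\<Sum>i\<in>insert i0 I. \<mu> i D *s f i D)"
    if "\<exists>\<nu>. g D = (\<Sum>i\<in>insert i0 I. \<nu> i *s f i D)" for D
  proof -
    from that obtain \<nu> where \<nu>: "g D = \<nu> i0 *s f i0 D + (\<Sum>i\<in>I. \<nu> i *s f i D)"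
      using insert.hyps by auto
    from \<mu>(2)[of D] show ?thesis
    proof (elim disjE bexE conjE)
      fix p assume p: "f i0 D $ p \<noteq> 0" and eq: "\<forall>k. \<mu> k D = ext p k D"
      have lin: "(\<Sum>i\<in>I. c i *s ?red p (f i) D)
          = (\<Sum>i\<in>I. c i *s f i D) - (\<Sum>i\<in>I. c i * (f i D $ p / f i0 D $ p)) *s f i0 D" for c
        by (simp add: vec.scale_right_diff_distrib sum_subtractf vec.scale_sum_left mult.assoc)
      have "?red p g D = (\<Sum>i\<in>I. \<nu> i *s ?red p (f i) D)"
        unfolding lin using p
        by (simp add: \<nu> add_divide_distrib sum_divide_distrib vec.scale_left_distrib)
      then have "?red p g D = (\<Sum>i\<in>I. lam p i D *s ?red p (f i) D)"
        by (rule lam(2))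
      then have "g D = (g D $ p / f i0 D $ p - (\<Sum>i\<in>I. lam p i D * (f i D $ p / f i0 D $ p))) *s f i0 D
          + (\<Sum>i\<in>I. lam p i D *s f i D)"
        unfolding lin by (simp add: algebra_simps vec.scale_left_diff_distrib)
      moreover have "(\<Sum>i\<in>I. lam p i D *s f i D) = (\<Sum>i\<in>I. \<mu> i D *s f i D)"
        using insert.hyps(2) by (intro sum.cong) (auto simp: eq ext_def)
      ultimately show ?thesis
        using insert.hyps by (simp add: eq ext_def)
    next
      assume z: "\<forall>p\<in>UNIV. f i0 D $ p = 0" and eq: "\<forall>k. \<mu> k D = ext0 k D"
      then have [simp]: "f i0 D = 0" by (simp add: vec_eq_iff)
      have "g D = (\<Sum>i\<in>I. lam0 i D *s f i D)"
        using \<nu> lam0(2) by auto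
      also have "\<dots> = (\<Sum>i\<in>I. \<mu> i D *s f i D)"
        using insert.hyps(2) by (intro sum.cong) (auto simp: eq ext0_def)
      finally show ?thesis using insert.hyps by simp
    qed
  qed
  with \<mu>(1) show ?case by blast
qed

section \<open>Solvability of the averaged equations\<close>

lemma kernel_sum_in:
  assumes "is_kernel_basis s a A0"
  shows "A0 *v (\<Sum>j=1..s. \<mu> j *s a j) = 0"
proof -
  have "(\<Sum>j=1..s. \<mu> j *s a j) \<in> vec.span (a ` {1..s})"
    by (intro vec.span_sum vec.span_scale vec.span_base) auto
  then show ?thesis using assms by (auto simp: is_kernel_basis_def)
qed

text \<open>Extend the kernel basis to a basis of the whole space and let \<open>h\<close> act as \<open>A1\<close> on the kernel and as
  \<open>A0\<close> on the span of the added vectors.  The hypothesis makes \<open>h\<close> injective, hence surjective;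
  this replaces the dimension count for the range of \<open>A0\<close> and the image of the kernel under \<open>A1\<close>.\<close>

lemma averaged_system_surjective:
  fixes A0 A1 :: "complex ^ ('n::finite) ^ 'n"
  assumes ker: "is_kernel_basis s a A0"
    and nosol: "\<And>\<mu> :: nat \<Rightarrow> complex. (\<exists>j\<in>{1..s}. \<mu> j \<noteq> 0) \<Longrightarrow>
          \<not> (\<exists>x. A0 *v x + A1 *v (\<Sum>j=1..s. \<mu> j *s a j) = 0)"
  shows "\<exists>x \<mu>. A0 *v x + A1 *v (\<Sum>j=1..s. \<mu> j *s a j) = g"
proof -
  let ?K = "a ` {1..s}"
  have ind: "vec.independent ?K" and inj: "inj_on a {1..s}"
    and span: "vec.span ?K = {v. A0 *v v = 0}"
    using ker by (auto simp: is_kernel_basis_def)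
  have kerE: "\<exists>\<mu>. v = (\<Sum>j=1..s. \<mu> j *s a j)" if "v \<in> vec.span ?K" for v
  proof -
    from that obtain u where "v = (\<Sum>w\<in>?K. u w *s w)"
      by (auto simp: vec.span_finite)
    also have "\<dots> = (\<Sum>j=1..s. u (a j) *s a j)"
      using inj by (simp add: sum.reindex)
    finally show ?thesis by (rule exI[of _ "\<lambda>j. u (a j)"])
  qed
  define E where "E = vec.extend_basis ?K"
  have E: "?K \<subseteq> E" "vec.independent E" "vec.span E = UNIV"
    using vec.extend_basis_superset[OF ind] vec.independent_extend_basis[OF ind]
      vec.span_extend_basis[OF ind] by (simp_all add: E_def)
  obtain h where h: "Vector_Spaces.linear (*s) (*s) h"
    and hE: "\<And>b. b \<in> E \<Longrightarrow> h b = (if b \<in> ?K then A1 *v b else A0 *v b)"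
    using vec.linear_independent_extend[OF E(2), of "\<lambda>b. if b \<in> ?K then A1 *v b else A0 *v b"]
    by blast
  have split: "\<exists>q r. v = q + r \<and> q \<in> vec.span ?K \<and> r \<in> vec.span (E - ?K)" for v
  proof -
    have "v \<in> vec.span (?K \<union> (E - ?K))"
      using E by (simp add: Un_absorb1)
    then show ?thesis unfolding vec.span_Un by blast
  qed
  have hq: "h q = A1 *v q" if "q \<in> vec.span ?K" for q
    by (rule vec.linear_eq_on[OF h _ that]) (use hE E(1) in \<open>auto intro: matrix_vector_mul_linear_gen\<close>)
  have hr: "h r = A0 *v r" if "r \<in> vec.span (E - ?K)" for r
    by (rule vec.linear_eq_on[OF h _ that]) (use hE in \<open>auto intro: matrix_vector_mul_linear_gen\<close>)
  have hv: "h (q + r) = A0 *v r + A1 *v q"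
    if "q \<in> vec.span ?K" "r \<in> vec.span (E - ?K)" for q r
    using hq hr that vec.linear_add[OF h] by (simp add: add.commute)
  \<comment> \<open>the projection onto the kernel along the added basis vectors separates the two spans\<close>
  obtain pr where pr: "Vector_Spaces.linear (*s) (*s) pr"
    and prE: "\<And>b. b \<in> E \<Longrightarrow> pr b = (if b \<in> ?K then b else 0)"
    using vec.linear_independent_extend[OF E(2), of "\<lambda>b. if b \<in> ?K then b else 0"]
    by blast
  have r0: "r = 0" if "r \<in> vec.span ?K" "r \<in> vec.span (E - ?K)" for r
  proof -
    have "pr r = r"
      by (rule vec.linear_eq_on[OF pr vec.linear_ident that(1)]) (use prE E(1) in auto)
    moreover have "pr r = 0"
      by (rule vec.linear_eq_0_on_span[OF pr _ that(2)]) (use prE in auto)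
    ultimately show ?thesis by simp
  qed
  have "inj h"
  proof (rule vec.linear_inj_iff_eq_0[OF h, THEN iffD2], intro allI impI)
    fix v assume v: "h v = 0"
    obtain q r where qr: "v = q + r" "q \<in> vec.span ?K" "r \<in> vec.span (E - ?K)"
      using split by blast
    obtain \<mu> where \<mu>: "q = (\<Sum>j=1..s. \<mu> j *s a j)" using kerE qr(2) by blast
    have 0: "A0 *v r + A1 *v q = 0" using v hv qr by simp
    then have "\<forall>j\<in>{1..s}. \<mu> j = 0" using nosol[of \<mu>] \<mu> by blast
    then have q0: "q = 0" using \<mu> by simp
    then have "r \<in> vec.span ?K" using 0 span by simp
    then have "r = 0"
      using r0 qr(3) by blast
    with q0 qr(1) show "v = 0" by simp
  qed
  then have "surj h" by (rule vec.linear_inj_imp_surj[OF h]) 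
  then obtain v where "g = h v" by (metis surjD)
  moreover obtain q r where "v = q + r" "q \<in> vec.span ?K" "r \<in> vec.span (E - ?K)"
    using split by blast
  ultimately show ?thesis using hv kerE by metis
qed

lemma averaged_A1_mult:
  "averaged_A1 m B *v v =
    B 0 *v v + (\<Sum>l\<in>osc_indices m. (1 / (\<i> * of_int l)) *s (B (- l) *v (B l *v v)))"
proof -
  have "(\<Sum>l\<in>osc_indices m. \<chi> p q. (B (- l) ** B l) $ p $ q / (\<i> * of_int l)) *v v
      = (\<Sum>l\<in>osc_indices m. (\<chi> p q. (B (- l) ** B l) $ p $ q / (\<i> * of_int l)) *v v)"
    by (induction rule: infinite_finite_induct) (auto simp: matrix_vector_mult_add_rdistrib)
  also have "\<dots> = (\<Sum>l\<in>osc_indices m. (1 / (\<i> * of_int l)) *s (B (- l) *v (B l *v v)))"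
    unfolding matrix_vector_mul_assoc
    by (intro sum.cong refl)
       (simp add: vec_eq_iff matrix_vector_mult_def sum_divide_distrib)
  finally show ?thesis
    by (simp add: averaged_A1_def matrix_vector_mult_add_rdistrib)
qed

definition row_apply :: "complex ^ 'n \<Rightarrow> complex ^ 'n \<Rightarrow> complex" where
  "row_apply r v = (\<Sum>q\<in>UNIV. r $ q * v $ q)"

lemma arith_row_apply:
  "arith_vec m s r \<Longrightarrow> arith_vec m s v \<Longrightarrow> (\<lambda>D. row_apply (r D) (v D)) \<in> arith_num m s"
  by (simp add: row_apply_def arith_vec_def arith_sum arith_num.mult)

lemma matrix_times_vector_sum:
  fixes M :: "complex ^ 'n ^ 'm"
  shows "M *v (\<Sum>j\<in>J. c j *s v j) = (\<Sum>j\<in>J. c j *s (M *v v j))"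
  by (induction J rule: infinite_finite_induct) (auto simp: vec.add vec.scale)

text \<open>\<open>P\<close> and the rows \<open>G j\<close> together invert \<open>(x, \<mu>) \<mapsto> A0 x + A1 (\<Sum>j. \<mu>\<^sub>j a\<^sub>j)\<close> from the right.\<close>

definition right_inverse_at :: "nat \<Rightarrow> nat \<Rightarrow> ('n::finite) data \<Rightarrow> complex ^ 'n ^ 'n \<Rightarrow> (nat \<Rightarrow> complex ^ 'n) \<Rightarrow> bool" where
  "right_inverse_at m s D P G \<longleftrightarrow> (\<forall>g. data_A0 D *v (P *v g) +
      averaged_A1 m (data_B D) *v (\<Sum>j=1..s. row_apply (G j) g *s data_a D j) = g)"

definition right_inverse_procedure ::
  "nat \<Rightarrow> nat \<Rightarrow> (('n::finite) data \<Rightarrow> complex ^ 'n ^ 'n) \<Rightarrow> (nat \<Rightarrow> 'n data \<Rightarrow> complex ^ 'n) \<Rightarrow> bool" where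
  "right_inverse_procedure m s P G \<longleftrightarrow>
    arith_mat m s P \<and> (\<forall>j\<in>{1..s}. arith_vec m s (G j)) \<and>
    (\<forall>D. (\<forall>g. \<exists>x \<mu>. data_A0 D *v x + averaged_A1 m (data_B D) *v (\<Sum>j=1..s. \<mu> j *s data_a D j) = g)
      \<longrightarrow> right_inverse_at m s D (P D) (\<lambda>j. G j D))"

text \<open>Apply elimination to the columns of \<open>A0\<close> and the vectors \<open>A1 a\<^sub>j\<close>, with each unit vector as right-hand side;
  the resulting coefficients are the columns of the right inverse.\<close>

lemma right_inverse_procedure_exists:
  "\<exists>P G. right_inverse_procedure m s P (G :: nat \<Rightarrow> ('n::finite) data \<Rightarrow> complex ^ 'n)"
proof -
  let ?A1 = "\<lambda>D :: 'n data. averaged_A1 m (data_B D)"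
  define f where "f = (\<lambda>i (D :: 'n data).
    case i of Inl q \<Rightarrow> column q (data_A0 D) | Inr j \<Rightarrow> ?A1 D *v data_a D j)"
  let ?I = "(UNIV :: 'n set) <+> {1..s}"
  have f: "arith_vec m s (f i)" if "i \<in> ?I" for i
  proof (cases i)
    case (Inl q)
    then show ?thesis
      using arith_mat_A0[where s = s and m = m and 'a = 'n]
      by (simp add: f_def arith_vec_def arith_mat_def column_def)
  next
    case (Inr j)
    then show ?thesis
      using that by (auto simp: f_def intro!: arith_vec_mult arith_mat_averaged arith_vec_a)
  qed
  have comb: "(\<Sum>i\<in>?I. c i *s f i D)
      = data_A0 D *v (\<chi> q. c (Inl q)) + ?A1 D *v (\<Sum>j=1..s. c (Inr j) *s data_a D j)" for c D
    by (simp add: sum.Plus f_def matrix_mult_sum[of "data_A0 D"] matrix_times_vector_sum)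
  have "\<forall>q. \<exists>lam. (\<forall>i\<in>?I. lam i \<in> arith_num m s) \<and>
    (\<forall>D. (\<exists>\<mu>. axis q 1 = (\<Sum>i\<in>?I. \<mu> i *s f i D)) \<longrightarrow> axis q 1 = (\<Sum>i\<in>?I. lam i D *s f i D))"
    by (intro allI arith_solve f)
       (auto simp: arith_vec_def axis_def arith_zero arith_num.one)
  then obtain lam where *: "\<forall>q. (\<forall>i\<in>?I. lam q i \<in> arith_num m s) \<and>
    (\<forall>D. (\<exists>\<mu>. axis q 1 = (\<Sum>i\<in>?I. \<mu> i *s f i D)) \<longrightarrow> axis q 1 = (\<Sum>i\<in>?I. lam q i D *s f i D))"
    unfolding choice_iff by (elim exE)
  have lam: "\<And>q i. i \<in> ?I \<Longrightarrow> lam q i \<in> arith_num m s"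
     "\<And>q D \<mu>. axis q 1 = (\<Sum>i\<in>?I. \<mu> i *s f i D) \<Longrightarrow> axis q 1 = (\<Sum>i\<in>?I. lam q i D *s f i D)"
    using * by (blast, meson)
  define P where "P = (\<lambda>D. \<chi> p q. lam q (Inl p) D)"
  define G where "G = (\<lambda>j D. \<chi> q. lam q (Inr j) D)"
  have "arith_mat m s P" "\<forall>j\<in>{1..s}. arith_vec m s (G j)"
    using lam(1) by (auto simp: arith_mat_def arith_vec_def P_def G_def)
  moreover have "right_inverse_at m s D (P D) (\<lambda>j. G j D)"
    if surj: "\<forall>g. \<exists>x \<mu>. data_A0 D *v x + ?A1 D *v (\<Sum>j=1..s. \<mu> j *s data_a D j) = g" for D
    unfolding right_inverse_at_def
  proof
    fix g :: "complex ^ 'n"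
    have "axis q 1 = (\<Sum>i\<in>?I. lam q i D *s f i D)" for q
    proof -
      obtain x \<mu> where "data_A0 D *v x + ?A1 D *v (\<Sum>j=1..s. \<mu> j *s data_a D j) = axis q 1"
        using surj by blast
      then have "axis q 1 = (\<Sum>i\<in>?I. case_sum (\<lambda>q. x $ q) \<mu> i *s f i D)"
        unfolding comb by simp
      then show ?thesis by (rule lam(2))
    qed
    then have "g = (\<Sum>q\<in>UNIV. g $ q *s (\<Sum>i\<in>?I. lam q i D *s f i D))"
      using basis_expansion[of g] by simp
    also have "\<dots> = (\<Sum>i\<in>?I. (\<Sum>q\<in>UNIV. g $ q * lam q i D) *s f i D)"
      unfolding vec.scale_sum_right vec.scale_sum_left by (subst sum.swap) simp
    also have "\<dots> = data_A0 D *v (P D *v g) +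
        ?A1 D *v (\<Sum>j=1..s. row_apply (G j D) g *s data_a D j)"
      unfolding comb
      by (simp add: P_def G_def row_apply_def matrix_vector_mult_def mult.commute)
    finally show "data_A0 D *v (P D *v g) +
        ?A1 D *v (\<Sum>j=1..s. row_apply (G j D) g *s data_a D j) = g" by simp
  qed
  ultimately have "right_inverse_procedure m s P G"
    unfolding right_inverse_procedure_def by blast
  then show ?thesis by blast
qed

section \<open>The recursion for the coefficients\<close>

text \<open>\<open>P\<close> and \<open>G\<close> stand for the two components of a right inverse as above.\<close>

locale averaged_recursion =
  fixes m s :: nat
    and A0 :: "complex ^ ('n::finite) ^ 'n" and B :: "int \<Rightarrow> complex ^ 'n ^ 'n"
    and d :: "int \<Rightarrow> complex ^ 'n" and a :: "nat \<Rightarrow> complex ^ 'n"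
    and P :: "complex ^ 'n ^ 'n" and G :: "nat \<Rightarrow> complex ^ 'n"
begin

text \<open>The Fourier coefficients of the part of \<open>y\<^sub>k\<^sub>+\<^sub>1\<close> that does not involve \<open>c\<^sub>k\<close>, computed from those of \<open>y\<^sub>k\<close> and
  \<open>y\<^sub>k\<^sub>-\<^sub>1\<close>.  At \<open>l = 0\<close> the factor is \<open>1 / 0 = 0\<close>, which removes the mean as required.  Since \<open>x\<close> is of order \<open>\<omega>\<close>, the
  forcing is smaller than \<open>A0 x\<close> by one power of \<open>\<epsilon>\<close> and enters at \<open>k = 1\<close>, not at \<open>k = 0\<close>.\<close>

definition osc_part ::
  "nat \<Rightarrow> (int \<Rightarrow> complex ^ 'n) \<Rightarrow> (int \<Rightarrow> complex ^ 'n) \<Rightarrow> int \<Rightarrow> complex ^ 'n" where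
  "osc_part k y y' l = (1 / (\<i> * of_int l)) *s
    (A0 *v y l + (\<Sum>j\<in>osc_indices m. B j *v y (l - j)) + B 0 *v y' l
      + (if k = 1 \<and> \<bar>l\<bar> \<le> int m then d l else 0))"

text \<open>The right-hand side \<open>f\<^sub>k\<close> of \<open>A0 p\<^sub>k\<^sub>+\<^sub>1 + A1 q\<^sub>k = f\<^sub>k\<close>.  This equation is the mean of the one for \<open>w\<^sub>k\<^sub>+\<^sub>2'\<close>, hence
  \<open>d 0\<close> already appears for \<open>k = 0\<close>.\<close>

definition mean_rhs :: "nat \<Rightarrow> (int \<Rightarrow> complex ^ 'n) \<Rightarrow> complex ^ 'n \<Rightarrow> complex ^ 'n" where
  "mean_rhs k z p = (if k = 0 then - d 0 else 0) - (\<Sum>j\<in>osc_indices m. B j *v z (- j))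
     - averaged_A1 m B *v p"

definition kernel_part :: "complex ^ 'n \<Rightarrow> complex ^ 'n" where
  "kernel_part f = (\<Sum>j=1..s. row_apply (G j) f *s a j)"

text \<open>The state after \<open>k\<close> steps is \<open>(y\<^sub>k, y\<^sub>k\<^sub>-\<^sub>1, p\<^sub>k)\<close>.  The kernel part \<open>q\<^sub>k\<close> is not in it: it becomes
  known only in the next step, together with \<open>p\<^sub>k\<^sub>+\<^sub>1\<close>.\<close>

primrec state :: "nat \<Rightarrow> (int \<Rightarrow> complex ^ 'n) \<times> (int \<Rightarrow> complex ^ 'n) \<times> (complex ^ 'n)" where
  "state 0 = ((\<lambda>l. 0), (\<lambda>l. 0), 0)"
| "state (Suc k) = (case state k of (y, y', p) \<Rightarrow>
    let z = osc_part k y y'; f = mean_rhs k z p; c = p + kernel_part f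
    in ((\<lambda>l. z l + (if l \<in> osc_indices m then (1 / (\<i> * of_int l)) *s (B l *v c) else 0)),
        y, P *v f))"

definition ycoef :: "nat \<Rightarrow> int \<Rightarrow> complex ^ 'n" where "ycoef k = fst (state k)"
definition yprev :: "nat \<Rightarrow> int \<Rightarrow> complex ^ 'n" where "yprev k = fst (snd (state k))"
definition pvec :: "nat \<Rightarrow> complex ^ 'n" where "pvec k = snd (snd (state k))"
definition zcoef :: "nat \<Rightarrow> int \<Rightarrow> complex ^ 'n" where "zcoef k = osc_part k (ycoef k) (yprev k)"
definition fvec :: "nat \<Rightarrow> complex ^ 'n" where "fvec k = mean_rhs k (zcoef k) (pvec k)"
definition cvec :: "nat \<Rightarrow> complex ^ 'n" where "cvec k = pvec k + kernel_part (fvec k)"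
definition wcoef :: "nat \<Rightarrow> int \<Rightarrow> complex ^ 'n" where
  "wcoef k l = ycoef k l + (if l = 0 then cvec k else 0)"

lemma ycoef_0: "ycoef 0 l = 0" and yprev_0: "yprev 0 l = 0" and pvec_0: "pvec 0 = 0"
  by (simp_all add: ycoef_def yprev_def pvec_def)

lemma ycoef_Suc: "ycoef (Suc k) l =
    zcoef k l + (if l \<in> osc_indices m then (1 / (\<i> * of_int l)) *s (B l *v cvec k) else 0)"
  and yprev_Suc: "yprev (Suc k) = ycoef k"
  and pvec_Suc: "pvec (Suc k) = P *v fvec k"
  by (simp_all add: ycoef_def yprev_def pvec_def zcoef_def fvec_def cvec_def split_def Let_def)

lemma ycoef_mean: "ycoef k 0 = 0"
  by (cases k) (simp_all add: ycoef_0 ycoef_Suc zcoef_def osc_part_def osc_indices_def)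

lemma ycoef_support: "int (m * k) < \<bar>l\<bar> \<Longrightarrow> ycoef k l = 0 \<and> yprev k l = 0"
proof (induction k arbitrary: l)
  case 0
  then show ?case by (simp add: ycoef_0 yprev_0)
next
  case (Suc k)
  have "int (m * Suc k) = int m + int (m * k)" "0 \<le> int (m * k)" by simp_all
  with Suc.prems have out: "int (m * k) < \<bar>l\<bar>" "\<not> \<bar>l\<bar> \<le> int m" by linarith+
  have "ycoef k (l - j) = 0" if "j \<in> osc_indices m" for j
    using Suc.prems that by (intro Suc.IH[THEN conjunct1]) (auto simp: osc_indices_def)
  then show ?case
    using out Suc.IH[OF out(1)]
    by (auto simp: ycoef_Suc yprev_Suc zcoef_def osc_part_def osc_indices_def)
qed

end

lemma arith_averaged_recursion:
  fixes P :: "('n::finite) data \<Rightarrow> complex ^ 'n ^ 'n"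
  assumes P: "arith_mat m s P" and G: "\<And>j. j \<in> {1..s} \<Longrightarrow> arith_vec m s (G j)"
  shows "arith_vec m s (\<lambda>D. averaged_recursion.ycoef m s (data_A0 D) (data_B D) (data_d D)
            (data_a D) (P D) (\<lambda>j. G j D) k l)" (is "arith_vec m s (\<lambda>D. ?y D k l)")
    and "arith_vec m s (\<lambda>D. averaged_recursion.pvec m s (data_A0 D) (data_B D) (data_d D)
            (data_a D) (P D) (\<lambda>j. G j D) k)" (is "arith_vec m s (\<lambda>D. ?p D k)")
    and "arith_vec m s (\<lambda>D. averaged_recursion.fvec m s (data_A0 D) (data_B D) (data_d D)
            (data_a D) (P D) (\<lambda>j. G j D) k)" (is "arith_vec m s (\<lambda>D. ?f D k)")
proof -
  let ?y' = "\<lambda>D. averaged_recursion.yprev m s (data_A0 D) (data_B D) (data_d D)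
            (data_a D) (P D) (\<lambda>j. G j D)"
  let ?z = "\<lambda>D. averaged_recursion.zcoef m s (data_A0 D) (data_B D) (data_d D)
            (data_a D) (P D) (\<lambda>j. G j D)"
  let ?c = "\<lambda>D. averaged_recursion.cvec m s (data_A0 D) (data_B D) (data_d D)
            (data_a D) (P D) (\<lambda>j. G j D)"
  have inv: "(\<lambda>D :: 'n data. 1 / (\<i> * of_int l)) \<in> arith_num m s" for l
    by (intro arith_num.intros arith_of_int)
  have osc: "\<bar>l\<bar> \<le> int m" if "l \<in> osc_indices m" for l
    using that by (simp add: osc_indices_def)
  have z: "arith_vec m s (\<lambda>D. ?z D k l)"
    if "\<And>l. arith_vec m s (\<lambda>D. ?y D k l)" "\<And>l. arith_vec m s (\<lambda>D. ?y' D k l)" for k l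
    using that osc arith_vec_d[of l m s] arith_vec_zero[of m s]
    unfolding averaged_recursion.zcoef_def averaged_recursion.osc_part_def
    by (cases "k = 1 \<and> \<bar>l\<bar> \<le> int m") (auto simp: inv intro!: arith_vec_scale arith_vec_add arith_vec_sum
         arith_vec_mult arith_mat_A0 arith_mat_B)
  have f: "arith_vec m s (\<lambda>D. ?f D k)"
    if "\<And>l. arith_vec m s (\<lambda>D. ?z D k l)" "arith_vec m s (\<lambda>D. ?p D k)" for k
    using that osc arith_vec_zero[of m s] arith_vec_diff[OF arith_vec_zero arith_vec_d[of 0 m s]]
    unfolding averaged_recursion.fvec_def averaged_recursion.mean_rhs_def
    by (intro arith_vec_diff arith_vec_sum arith_vec_mult arith_mat_averaged arith_mat_B)
       (cases "k = 0"; simp)+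
  have c: "arith_vec m s (\<lambda>D. ?c D k)"
    if "arith_vec m s (\<lambda>D. ?p D k)" "arith_vec m s (\<lambda>D. ?f D k)" for k
    using that G unfolding averaged_recursion.cvec_def averaged_recursion.kernel_part_def
    by (auto intro!: arith_vec_add arith_vec_sum arith_vec_scale arith_row_apply arith_vec_a)
  have all: "(\<forall>l. arith_vec m s (\<lambda>D. ?y D k l)) \<and> (\<forall>l. arith_vec m s (\<lambda>D. ?y' D k l)) \<and>
      arith_vec m s (\<lambda>D. ?p D k)"
  proof (induction k)
    case 0
    then show ?case
      by (simp add: averaged_recursion.ycoef_0 averaged_recursion.yprev_0
          averaged_recursion.pvec_0 arith_vec_zero)
  next
    case (Suc k)
    then have z: "\<And>l. arith_vec m s (\<lambda>D. ?z D k l)" using z by blast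
    then have f: "arith_vec m s (\<lambda>D. ?f D k)" using f Suc by blast
    then have c: "arith_vec m s (\<lambda>D. ?c D k)" using c Suc by blast
    have "arith_vec m s (\<lambda>D. ?y D (Suc k) l)" for l
      using osc[of l] by (cases "l \<in> osc_indices m")
        (auto simp: averaged_recursion.ycoef_Suc
           intro!: arith_vec_add z arith_vec_scale inv arith_vec_mult arith_mat_B c)
    moreover have "arith_vec m s (\<lambda>D. ?p D (Suc k))"
      unfolding averaged_recursion.pvec_Suc by (intro arith_vec_mult P f)
    ultimately show ?case using Suc by (simp add: averaged_recursion.yprev_Suc)
  qed
  then show "arith_vec m s (\<lambda>D. ?y D k l)" "arith_vec m s (\<lambda>D. ?p D k)" by auto
  show "arith_vec m s (\<lambda>D. ?f D k)" using all f z by blast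
qed

lemma osc_indices_uminus: "bij_betw uminus (osc_indices m) (osc_indices m)"
  by (intro bij_betwI[of _ _ _ uminus]) (auto simp: osc_indices_def)

lemma finite_osc_indices: "finite (osc_indices m)"
  by (rule finite_subset[of _ "{- int m..int m}"]) (auto simp: osc_indices_def)

locale averaged_system = averaged_recursion m s A0 B d a P G
  for m s and A0 :: "complex ^ ('n::finite) ^ 'n" and B d a P G +
  assumes right_inverse: "A0 *v (P *v f) + averaged_A1 m B *v kernel_part f = f"
    and kernel: "A0 *v kernel_part f = 0"
begin

text \<open>The part \<open>B\<^sub>l c / (il)\<close> of \<open>y\<^sub>k\<close> that stems from the previous mean contributes
  \<open>\<Sum>l. B\<^sub>-\<^sub>l B\<^sub>l c / (il) = (A1 - B\<^sub>0) c\<close> to the mean of \<open>S y\<^sub>k\<close>; what remains is the equation solved by the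
  right inverse.\<close>

lemma mean_balance:
  assumes "0 < k"
  shows "A0 *v cvec k + (\<Sum>j\<in>osc_indices m. B j *v ycoef k (- j)) + B 0 *v cvec (k - 1)
    + (if k = 1 then d 0 else 0) = 0"
proof -
  obtain i where k: "k = Suc i" using assms by (cases k) auto
  have neg: "- j \<in> osc_indices m \<longleftrightarrow> j \<in> osc_indices m" for j
    by (auto simp: osc_indices_def)
  have "(\<Sum>j\<in>osc_indices m. B j *v ycoef k (- j))
      = (\<Sum>j\<in>osc_indices m. B j *v zcoef i (- j))
        + (\<Sum>j\<in>osc_indices m. (1 / (\<i> * of_int (- j))) *s (B j *v (B (- j) *v cvec i)))"
    by (simp add: k ycoef_Suc neg vec.add vec.scale sum.distrib del: of_int_minus)
  also have "(\<Sum>j\<in>osc_indices m. (1 / (\<i> * of_int (- j))) *s (B j *v (B (- j) *v cvec i)))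
      = (\<Sum>j\<in>osc_indices m. (1 / (\<i> * of_int j)) *s (B (- j) *v (B j *v cvec i)))"
    using sum.reindex_bij_betw[OF osc_indices_uminus[of m],
        of "\<lambda>j. (1 / (\<i> * of_int j)) *s (B (- j) *v (B j *v cvec i))"] by simp
  also have "\<dots> = averaged_A1 m B *v cvec i - B 0 *v cvec i"
    by (simp add: averaged_A1_mult)
  finally have "A0 *v cvec k + (\<Sum>j\<in>osc_indices m. B j *v ycoef k (- j)) + B 0 *v cvec i
      + (if i = 0 then d 0 else 0)
    = A0 *v pvec k + averaged_A1 m B *v kernel_part (fvec i) - fvec i"
    by (auto simp: cvec_def kernel vec.add fvec_def mean_rhs_def)
  also have "\<dots> = 0" using right_inverse[of "fvec i"] by (simp add: k pvec_Suc)
  finally show ?thesis by (simp add: k)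
qed

text \<open>The equation for \<open>w\<^sub>k\<^sub>+\<^sub>1'\<close> at frequency \<open>l\<close>: for \<open>l \<noteq> 0\<close> by construction of \<open>y\<^sub>k\<^sub>+\<^sub>1\<close>, for \<open>l = 0\<close> by the
  balance of means.\<close>

lemma wcoef_recursion:
  "(\<i> * of_int l) *s wcoef (Suc k) l = A0 *v wcoef k l
     + (\<Sum>j\<in>osc_indices m. B j *v wcoef k (l - j))
     + B 0 *v (if k = 0 then 0 else wcoef (k - 1) l)
     + (if k = 1 \<and> \<bar>l\<bar> \<le> int m then d l else 0)"
proof (cases "l = 0")
  case True
  have w0: "wcoef i 0 = cvec i" for i
    by (simp add: wcoef_def ycoef_mean)
  have "wcoef k (- j) = ycoef k (- j)" if "j \<in> osc_indices m" for j
    using that by (auto simp: wcoef_def osc_indices_def)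
  then have eq: "(\<Sum>j\<in>osc_indices m. B j *v wcoef k (- j)) = (\<Sum>j\<in>osc_indices m. B j *v ycoef k (- j))"
    by (intro sum.cong) auto
  show ?thesis
  proof (cases "k = 0")
    case k: True
    have "A0 *v cvec 0 = 0" by (simp add: cvec_def pvec_0 kernel)
    moreover have "(\<Sum>j\<in>osc_indices m. B j *v wcoef k (- j)) = 0"
      unfolding eq by (simp add: k ycoef_0)
    ultimately show ?thesis using True k by (simp add: w0)
  next
    case k: False
    with True mean_balance[of k] show ?thesis by (simp add: w0 eq split: if_splits)
  qed
next
  case False
  have sum: "(\<Sum>j\<in>osc_indices m. B j *v wcoef k (l - j))
      = (\<Sum>j\<in>osc_indices m. B j *v ycoef k (l - j))
        + (if l \<in> osc_indices m then B l *v cvec k else 0)"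
  proof -
    have "(\<Sum>j\<in>osc_indices m. B j *v wcoef k (l - j))
      = (\<Sum>j\<in>osc_indices m. B j *v ycoef k (l - j) + (if l = j then B j *v cvec k else 0))"
      by (intro sum.cong) (auto simp: wcoef_def vec.add)
    then show ?thesis by (simp add: sum.distrib sum.delta finite_osc_indices)
  qed
  have prev: "yprev k l = (if k = 0 then 0 else wcoef (k - 1) l)"
    using False by (cases k) (auto simp: yprev_0 yprev_Suc wcoef_def)
  have "(\<i> * of_int l) *s wcoef (Suc k) l = (\<i> * of_int l) *s zcoef k l
      + (if l \<in> osc_indices m then B l *v cvec k else 0)"
    using False by (simp add: wcoef_def ycoef_Suc vec.scale_right_distrib)
  also have "(\<i> * of_int l) *s zcoef k l =
    A0 *v ycoef k l + (\<Sum>j\<in>osc_indices m. B j *v ycoef k (l - j)) + B 0 *v yprev k l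
      + (if k = 1 \<and> \<bar>l\<bar> \<le> int m then d l else 0)"
    using False by (simp add: zcoef_def osc_part_def)
  finally show ?thesis
    unfolding sum prev using False by (simp add: wcoef_def)
qed

end

section \<open>Geometric growth of the coefficients\<close>

lemma norm_vector_scale: "norm (c *s v) = norm c * norm v" for v :: "complex ^ ('n::finite)"
  by (simp add: norm_vec_def L2_set_right_distrib norm_mult)

lemma bounded_bilinear_scale: "bounded_bilinear (\<lambda>c (v :: complex ^ ('n::finite)). c *s v)"
proof
  show "\<exists>K. \<forall>c v :: complex ^ 'n. norm (c *s v) \<le> norm c * norm v * K"
    by (intro exI[of _ 1]) (simp add: norm_vector_scale)
qed (simp_all add: vec.scale_left_distrib vec.scale_right_distrib vec_eq_iff
      scaleR_conv_of_real[where 'a = complex])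

lemmas bounded_linear_scale_left = bounded_bilinear.bounded_linear_left[OF bounded_bilinear_scale]
lemmas bounded_linear_scale_right = bounded_bilinear.bounded_linear_right[OF bounded_bilinear_scale]

lemma matrix_bound:
  fixes A :: "complex ^ ('n::finite) ^ 'n"
  obtains K where "0 \<le> K" "\<And>v. norm (A *v v) \<le> K * norm v"
  using bounded_linear.nonneg_bounded[OF matrix_vector_mul_bounded_linear[of A]]
  by (metis mult.commute)

lemma norm_inverse_il: "norm (1 / (\<i> * of_int l)) \<le> 1"
proof (cases "l = 0")
  case False
  then have "1 \<le> \<bar>real_of_int l\<bar>" by linarith
  then show ?thesis by (simp add: norm_divide norm_mult)
qed simp

lemma norm_sum_osc_le:
  assumes "\<And>j. j \<in> osc_indices m \<Longrightarrow> norm (g j) \<le> b"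
  shows "norm (\<Sum>j\<in>osc_indices m. g j) \<le> real (card (osc_indices m)) * b"
  by (rule sum_norm_bound) (rule assms)

context averaged_recursion
begin

lemma kernel_part_matrix: "\<exists>Q. \<forall>f. kernel_part f = Q *v f"
proof (intro exI allI)
  fix f
  show "kernel_part f = (\<chi> p q. \<Sum>j=1..s. G j $ q * a j $ p) *v f"
    by (simp add: kernel_part_def row_apply_def vec_eq_iff matrix_vector_mult_def
        sum_distrib_right sum_distrib_left) (subst sum.swap, simp add: mult_ac)
qed

text \<open>A single constant \<open>K\<close> for all operators keeps the later estimates polynomial in \<open>K\<close>.\<close>

lemma coefficient_bounds:
  obtains K where "1 \<le> K" "\<And>v. norm (A0 *v v) \<le> K * norm v"
    "\<And>l v. \<bar>l\<bar> \<le> int m \<Longrightarrow> norm (B l *v v) \<le> K * norm v"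
    "\<And>v. norm (averaged_A1 m B *v v) \<le> K * norm v"
    "\<And>v. norm (P *v v) \<le> K * norm v"
    "\<And>v. norm (kernel_part v) \<le> K * norm v"
    "\<And>l. \<bar>l\<bar> \<le> int m \<Longrightarrow> norm (d l) \<le> K"
    "real (card (osc_indices m)) \<le> K"
proof -
  let ?L = "{- int m..int m}"
  obtain KA where KA: "0 \<le> KA" "\<And>v. norm (A0 *v v) \<le> KA * norm v"
    using matrix_bound[of A0] by blast
  obtain K1 where K1: "0 \<le> K1" "\<And>v. norm (averaged_A1 m B *v v) \<le> K1 * norm v"
    using matrix_bound[of "averaged_A1 m B"] by blast
  obtain KP where KP: "0 \<le> KP" "\<And>v. norm (P *v v) \<le> KP * norm v"
    using matrix_bound[of P] by blast
  obtain Q where Q: "\<And>f. kernel_part f = Q *v f" using kernel_part_matrix by blast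
  obtain KQ where KQ: "0 \<le> KQ" "\<And>v. norm (kernel_part v) \<le> KQ * norm v"
    using matrix_bound[of Q] unfolding Q by blast
  have "\<forall>l. \<exists>K. 0 \<le> K \<and> (\<forall>v. norm (B l *v v) \<le> K * norm v)"
    using matrix_bound by metis
  then obtain b where b: "\<And>l. 0 \<le> b l" "\<And>l v. norm (B l *v v) \<le> b l * norm v"
    by metis
  define K where "K = 1 + KA + K1 + KP + KQ + (\<Sum>l\<in>?L. b l) + (\<Sum>l\<in>?L. norm (d l))
     + real (card (osc_indices m))"
  have nn: "0 \<le> (\<Sum>l\<in>?L. b l)" "0 \<le> (\<Sum>l\<in>?L. norm (d l))"
    using b by (auto intro: sum_nonneg)
  have bl: "b l \<le> (\<Sum>l\<in>?L. b l)" "norm (d l) \<le> (\<Sum>l\<in>?L. norm (d l))" if "\<bar>l\<bar> \<le> int m" for l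
    using that b by (auto intro!: member_le_sum)
  have le: "KA \<le> K" "K1 \<le> K" "KP \<le> K" "KQ \<le> K" "1 \<le> K" "real (card (osc_indices m)) \<le> K"
    "(\<Sum>l\<in>?L. b l) \<le> K" "(\<Sum>l\<in>?L. norm (d l)) \<le> K"
    using nn KA(1) K1(1) KP(1) KQ(1) by (simp_all add: K_def)
  show thesis
  proof
    show "norm (A0 *v v) \<le> K * norm v" "norm (averaged_A1 m B *v v) \<le> K * norm v"
      "norm (P *v v) \<le> K * norm v" "norm (kernel_part v) \<le> K * norm v" for v
      using KA(2) K1(2) KP(2) KQ(2) le by (meson mult_right_mono norm_ge_zero order_trans)+
    show "norm (B l *v v) \<le> K * norm v" if "\<bar>l\<bar> \<le> int m" for l v
      using b(2)[of l v] bl(1)[OF that] le(7)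
      by (meson mult_right_mono norm_ge_zero order_trans)
    show "norm (d l) \<le> K" if "\<bar>l\<bar> \<le> int m" for l
      using bl(2)[OF that] le(8) by linarith
  qed (use le in auto)
qed

text \<open>One step of the recursion multiplies a common bound \<open>N \<ge> 1\<close> on the state by at most \<open>11 K^6\<close>.
  Requiring \<open>N \<ge> 1\<close> lets the inhomogeneities of the first two steps be absorbed in the same factor.
  The coefficients are bounded frequency by frequency; passing to functions costs a factor linear in \<open>k\<close>.\<close>

lemma coefficients_geometric:
  obtains R where "1 \<le> R" "\<And>k l. norm (ycoef k l) \<le> R ^ k" "\<And>k. norm (cvec k) \<le> R ^ (k + 1)"
proof -
  obtain K where K1: "1 \<le> K" and A0: "\<And>v. norm (A0 *v v) \<le> K * norm v"
    and B: "\<And>l v. \<bar>l\<bar> \<le> int m \<Longrightarrow> norm (B l *v v) \<le> K * norm v"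
    and A1: "\<And>v. norm (averaged_A1 m B *v v) \<le> K * norm v"
    and P: "\<And>v. norm (P *v v) \<le> K * norm v"
    and Q: "\<And>v. norm (kernel_part v) \<le> K * norm v"
    and d: "\<And>l. \<bar>l\<bar> \<le> int m \<Longrightarrow> norm (d l) \<le> K"
    and card: "real (card (osc_indices m)) \<le> K"
    using coefficient_bounds by blast
  have K0: "0 \<le> K" using K1 by simp
  have pw: "K ^ i \<le> K ^ j" if "i \<le> j" for i j using K1 that by (rule power_increasing[rotated])
  have osc: "\<bar>l\<bar> \<le> int m" if "l \<in> osc_indices m" for l
    using that by (simp add: osc_indices_def)
  have step:
    "norm (zcoef k l) \<le> 4 * K ^ 2 * N \<and> norm (fvec k) \<le> 6 * K ^ 4 * N
      \<and> norm (cvec k) \<le> 7 * K ^ 5 * N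
      \<and> norm (pvec (Suc k)) \<le> 6 * K ^ 5 * N \<and> norm (ycoef (Suc k) l) \<le> 11 * K ^ 6 * N"
    if N: "1 \<le> N" and y: "\<And>l. norm (ycoef k l) \<le> N" and y': "\<And>l. norm (yprev k l) \<le> N"
      and p: "norm (pvec k) \<le> N" for k N l
  proof -
    have N0: "0 \<le> N" using N by simp
    have up: "K ^ i * N \<le> K ^ j * N" if "i \<le> j" for i j
      using pw[OF that] N0 by (rule mult_right_mono)
    have mono: "K * x \<le> K * b" if "x \<le> b" for x b using that K0 by (rule mult_left_mono)
    have z: "norm (zcoef k l) \<le> 4 * K ^ 2 * N" for l
    proof -
      let ?S = "\<Sum>j\<in>osc_indices m. B j *v ycoef k (l - j)"
      let ?d = "if k = 1 \<and> \<bar>l\<bar> \<le> int m then d l else 0"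
      have 1: "norm (A0 *v ycoef k l) \<le> K * N"
        using order_trans[OF A0 mono[OF y]] .
      have "norm ?S \<le> real (card (osc_indices m)) * (K * N)"
        using order_trans[OF B mono[OF y]] osc by (intro norm_sum_osc_le) blast
      also have "\<dots> \<le> K * (K * N)"
        using card K0 N0 by (intro mult_right_mono) auto
      finally have 2: "norm ?S \<le> K * (K * N)" .
      have 3: "norm (B 0 *v yprev k l) \<le> K * N"
        using order_trans[OF B mono[OF y']] by simp
      have "K * 1 \<le> K * N" by (rule mono[OF N])
      then have 4: "norm ?d \<le> K * N" using d[of l] K0 N0 by auto
      have "norm (zcoef k l)
          \<le> 1 * norm (A0 *v ycoef k l + ?S + B 0 *v yprev k l + ?d)"
        unfolding zcoef_def osc_part_def norm_vector_scale
        by (intro mult_right_mono norm_inverse_il norm_ge_zero)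
      also have "\<dots> \<le> K * N + K * (K * N) + K * N + K * N"
        using norm_triangle_ineq[of "A0 *v ycoef k l + ?S + B 0 *v yprev k l" ?d]
          norm_triangle_ineq[of "A0 *v ycoef k l + ?S" "B 0 *v yprev k l"]
          norm_triangle_ineq[of "A0 *v ycoef k l" ?S] 1 2 3 4 by linarith
      also have "\<dots> \<le> 4 * K ^ 2 * N"
        using up[of 1 2] by (simp add: power2_eq_square)
      finally show ?thesis .
    qed
    have f: "norm (fvec k) \<le> 6 * K ^ 4 * N"
    proof -
      let ?S = "\<Sum>j\<in>osc_indices m. B j *v zcoef k (- j)"
      let ?d = "if k = 0 then - d 0 else 0"
      have "norm ?S \<le> real (card (osc_indices m)) * (K * (4 * K ^ 2 * N))"
        using order_trans[OF B mono[OF z]] osc by (intro norm_sum_osc_le) blast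
      also have "\<dots> \<le> K * (K * (4 * K ^ 2 * N))"
        using card K0 N0 by (intro mult_right_mono) auto
      finally have 2: "norm ?S \<le> K * (K * (4 * K ^ 2 * N))" .
      have 3: "norm (averaged_A1 m B *v pvec k) \<le> K * N"
        using order_trans[OF A1 mono[OF p]] .
      have "K * 1 \<le> K * N" by (rule mono[OF N])
      then have 4: "norm ?d \<le> K * N" using d[of 0] K0 N0 by auto
      have "norm (fvec k) \<le> K * N + K * (K * (4 * K ^ 2 * N)) + K * N"
        unfolding fvec_def mean_rhs_def
        using norm_triangle_ineq4[of "?d - ?S" "averaged_A1 m B *v pvec k"]
          norm_triangle_ineq4[of ?d ?S] 2 3 4 by linarith
      also have "\<dots> \<le> 6 * K ^ 4 * N"
        using up[of 1 4] by (simp add: power2_eq_square power4_eq_xxxx mult_ac)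
      finally show ?thesis .
    qed
    have q: "norm (kernel_part (fvec k)) \<le> 6 * K ^ 5 * N"
      using order_trans[OF Q mono[OF f]] by (simp add: eval_nat_numeral mult_ac)
    have p': "norm (pvec (Suc k)) \<le> 6 * K ^ 5 * N"
      using order_trans[OF P mono[OF f]] by (simp add: eval_nat_numeral mult_ac pvec_Suc)
    have c: "norm (cvec k) \<le> 7 * K ^ 5 * N"
      unfolding cvec_def
      using norm_triangle_ineq[of "pvec k" "kernel_part (fvec k)"] p q up[of 0 5] by simp
    have "norm (ycoef (Suc k) l) \<le> 4 * K ^ 2 * N + K * (7 * K ^ 5 * N)"
    proof -
      have "norm (if l \<in> osc_indices m then (1 / (\<i> * of_int l)) *s (B l *v cvec k) else 0)
          \<le> 1 * (K * (7 * K ^ 5 * N))"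
      proof (cases "l \<in> osc_indices m")
        case True
        show ?thesis
          unfolding if_P[OF True] norm_vector_scale
          by (intro mult_mono norm_inverse_il order_trans[OF B[OF osc[OF True]] mono[OF c]]) auto
      qed (use K0 N0 in simp)
      then show ?thesis
        unfolding ycoef_Suc by (intro norm_triangle_mono z) simp
    qed
    also have "\<dots> \<le> 11 * K ^ 6 * N"
      using up[of 2 6] by (simp add: eval_nat_numeral mult_ac)
    finally show ?thesis using z f c p' by blast
  qed
  define R where "R = 11 * K ^ 6"
  have R: "7 * K ^ 5 \<le> R" "6 * K ^ 5 \<le> R" "1 \<le> R" "0 \<le> R"
    using pw[of 5 6] pw[of 0 5] pw[of 0 6] by (simp_all add: R_def)
  have all: "(\<forall>l. norm (ycoef k l) \<le> R ^ k) \<and> (\<forall>l. norm (yprev k l) \<le> R ^ k)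
    \<and> norm (pvec k) \<le> R ^ k" for k
  proof (induction k)
    case 0
    then show ?case by (simp add: ycoef_0 yprev_0 pvec_0)
  next
    case (Suc k)
    have N: "1 \<le> R ^ k" using R(3) by simp
    have "R ^ k \<le> R ^ Suc k" using R(3) by (intro power_increasing) auto
    moreover have "6 * K ^ 5 * R ^ k \<le> R ^ Suc k"
      using R(2,4) by (simp add: mult_right_mono)
    moreover have "norm (ycoef (Suc k) l) \<le> R ^ Suc k" "norm (pvec (Suc k)) \<le> 6 * K ^ 5 * R ^ k" for l
      using step[OF N, of k l] Suc unfolding power_Suc R_def by blast+
    ultimately show ?case
      using Suc unfolding yprev_Suc by (meson order_trans)
  qed
  have "norm (cvec k) \<le> R ^ (k + 1)" for k
  proof -
    have "norm (cvec k) \<le> 7 * K ^ 5 * R ^ k"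
      using step[of "R ^ k" k] all[of k] R(3) by simp
    also have "\<dots> \<le> R ^ (k + 1)" using R(1,4) by (simp add: mult_right_mono)
    finally show ?thesis .
  qed
  with all R(3) show thesis using that by blast
qed

end

section \<open>Trigonometric polynomials\<close>

definition trig :: "nat \<Rightarrow> (int \<Rightarrow> complex ^ 'n) \<Rightarrow> real \<Rightarrow> complex ^ 'n" where
  "trig N u \<tau> = (\<Sum>l\<in>{- int N..int N}. exp (\<i> * of_int l * of_real \<tau>) *s u l)"

lemma norm_exp_osc: "norm (exp (\<i> * of_int l * of_real \<tau>)) = 1"
  by (simp add: norm_exp_eq_Re)

lemma trig_extend:
  assumes "\<And>l. int N < \<bar>l\<bar> \<Longrightarrow> u l = 0" "N \<le> M"
  shows "trig M u \<tau> = trig N u \<tau>"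
  unfolding trig_def using assms by (intro sum.mono_neutral_right) (auto simp: abs_if)

lemma trig_add: "trig N (\<lambda>l. u l + v l) \<tau> = trig N u \<tau> + trig N v \<tau>"
  by (simp add: trig_def vec.scale_right_distrib sum.distrib)

lemma trig_mult: "trig N (\<lambda>l. M *v u l) \<tau> = M *v trig N u \<tau>"
  by (simp add: trig_def matrix_times_vector_sum)

lemma trig_sum: "trig N (\<lambda>l. \<Sum>j\<in>J. u j l) \<tau> = (\<Sum>j\<in>J. trig N (u j) \<tau>)"
  unfolding trig_def vec.scale_sum_right by (rule sum.swap)

lemma trig_shift:
  assumes "\<And>l. int N < \<bar>l\<bar> \<Longrightarrow> u l = 0" "int N + \<bar>j\<bar> \<le> int M"
  shows "trig M (\<lambda>l. u (l - j)) \<tau> = exp (\<i> * of_int j * of_real \<tau>) *s trig N u \<tau>"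
proof -
  have "trig M (\<lambda>l. u (l - j)) \<tau>
      = (\<Sum>l\<in>{- int N + j..int N + j}. exp (\<i> * of_int l * of_real \<tau>) *s u (l - j))"
    unfolding trig_def using assms by (intro sum.mono_neutral_right) (auto simp: abs_if split: if_splits)
  also have "\<dots> = (\<Sum>l\<in>{- int N..int N}. exp (\<i> * of_int (l + j) * of_real \<tau>) *s u l)"
    by (rule sum.reindex_bij_witness[of _ "\<lambda>l. l + j" "\<lambda>l. l - j"]) auto
  also have "\<dots> = exp (\<i> * of_int j * of_real \<tau>) *s trig N u \<tau>"
    by (simp add: trig_def vec.scale_sum_right exp_add[symmetric] algebra_simps)
  finally show ?thesis .
qed

lemma exp_has_vector_derivative:
  "((\<lambda>\<tau>. exp (\<i> * of_int l * of_real \<tau>)) has_vector_derivative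
     \<i> * of_int l * exp (\<i> * of_int l * of_real \<tau>)) (at \<tau> within S)"
  by (rule has_vector_derivative_real_field) (auto intro!: derivative_eq_intros)

lemma trig_has_vector_derivative:
  "(trig N u has_vector_derivative trig N (\<lambda>l. (\<i> * of_int l) *s u l) \<tau>) (at \<tau> within S)"
proof -
  have "((\<lambda>\<tau>. \<Sum>l\<in>{- int N..int N}. exp (\<i> * of_int l * of_real \<tau>) *s u l) has_vector_derivative
     (\<Sum>l\<in>{- int N..int N}. (\<i> * of_int l * exp (\<i> * of_int l * of_real \<tau>)) *s u l)) (at \<tau> within S)"
    by (intro has_vector_derivative_sum
        bounded_linear.has_vector_derivative[OF bounded_linear_scale_left] exp_has_vector_derivative)
  then show ?thesis by (simp add: trig_def[abs_def] mult.commute)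
qed

lemma exp_osc_periodic:
  "exp (\<i> * of_int l * of_real (\<tau> + 2 * pi)) = exp (\<i> * of_int l * of_real \<tau>)"
  using exp_plus_2pin[of "\<i> * of_int l * of_real \<tau>" l] by (simp add: algebra_simps)

lemma trig_periodic: "trig N u (\<tau> + 2 * pi) = trig N u \<tau>"
  unfolding trig_def exp_osc_periodic by (rule refl)

lemma trig_continuous: "continuous_on UNIV (trig N u)"
  by (intro continuous_at_imp_continuous_on ballI
      has_vector_derivative_continuous[OF trig_has_vector_derivative])

lemma trig_mean:
  assumes "u 0 = 0"
  shows "mean (2 * pi) (trig N u) = 0"
proof -
  let ?U = "trig N (\<lambda>l. (1 / (\<i> * of_int l)) *s u l)"
  have "(\<i> * of_int l) *s ((1 / (\<i> * of_int l)) *s u l) = u l" for l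
    using assms by (cases "l = 0") auto
  then have "(?U has_vector_derivative trig N u \<tau>) (at \<tau> within {0..2 * pi})" for \<tau>
    using trig_has_vector_derivative[of N "\<lambda>l. (1 / (\<i> * of_int l)) *s u l"] by simp
  then have "(trig N u has_integral ?U (2 * pi) - ?U 0) {0..2 * pi}"
    by (intro fundamental_theorem_of_calculus) auto
  moreover have "?U (2 * pi) = ?U 0" using trig_periodic[of N _ 0] by simp
  ultimately show ?thesis by (simp add: mean_def integral_unique)
qed

lemma norm_trig_le:
  assumes "\<And>l. norm (u l) \<le> b"
  shows "norm (trig N u \<tau>) \<le> (2 * real N + 1) * b"
proof -
  have "norm (trig N u \<tau>) \<le> real (card {- int N..int N}) * b"
    unfolding trig_def by (rule sum_norm_bound) (simp add: norm_vector_scale assms)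
  then show ?thesis by (simp add: nat_add_distrib add.commute)
qed

text \<open>The known exponentials include those with \<open>l = 1\<close> and \<open>l = -1\<close>; the others are their powers.\<close>

lemma arith_fun_exp:
  assumes "0 < m"
  shows "(\<lambda>D \<tau>. exp (\<i> * of_int l * of_real \<tau>)) \<in> arith_fun m s"
proof -
  have pow: "(\<lambda>D \<tau>. exp (\<i> * of_int e * of_real \<tau>) ^ k) \<in> arith_fun m s" if "e \<in> {1, -1}" for e k
  proof (induction k)
    case 0
    then show ?case using arith_fun.const[OF arith_num.one] by simp
  next
    case (Suc k)
    have "e \<in> osc_indices m" using assms that by (auto simp: osc_indices_def)
    from arith_fun.mult[OF arith_fun.expo[OF this] Suc] show ?case by simp
  qed
  show ?thesis
  proof (cases l rule: int_cases2)
    case (nonneg n)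
    then show ?thesis using pow[of 1 n] by (simp flip: exp_of_nat_mult add: mult_ac)
  next
    case (nonpos n)
    then show ?thesis using pow[of "-1" n] by (simp flip: exp_of_nat_mult add: mult_ac)
  qed
qed

lemma arith_fun_sum:
  assumes "\<And>i. i \<in> I \<Longrightarrow> f i \<in> arith_fun m s"
  shows "(\<lambda>D \<tau>. \<Sum>i\<in>I. f i D \<tau>) \<in> arith_fun m s"
  using assms
proof (induction I rule: infinite_finite_induct)
  case (insert i I)
  then show ?case by (auto intro: arith_fun.add)
qed (use arith_fun.const[OF arith_zero] in auto)

lemma arith_fun_trig:
  assumes "\<And>l. arith_vec m s (u l)"
  shows "(\<lambda>D \<tau>. trig (m * k) (\<lambda>l. u l D) \<tau> $ p) \<in> arith_fun m s"
proof -
  have e: "(\<lambda>D \<tau>. exp (\<i> * of_int l * of_real \<tau>)) \<in> arith_fun m s"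
    if "l \<in> {- int (m * k)..int (m * k)}" for l
  proof (cases "m = 0")
    case True
    then show ?thesis using that arith_fun.const[OF arith_num.one] by simp
  qed (simp add: arith_fun_exp)
  have "(\<lambda>D \<tau>. u l D $ p) \<in> arith_fun m s" for l
    using assms by (auto simp: arith_vec_def intro: arith_fun.const)
  then have "(\<lambda>D \<tau>. \<Sum>l\<in>{- int (m * k)..int (m * k)}. exp (\<i> * of_int l * of_real \<tau>) * u l D $ p)
      \<in> arith_fun m s"
    by (intro arith_fun_sum arith_fun.mult e)
  then show ?thesis by (simp add: trig_def)
qed

section \<open>The series is a periodic solution\<close>

lemma has_vector_derivative_suminf:
  fixes f :: "nat \<Rightarrow> real \<Rightarrow> 'a::banach"
  assumes der: "\<And>n t. (f n has_vector_derivative f' n t) (at t)"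
    and bound: "\<And>n t. norm (f' n t) \<le> M n" and "summable M"
    and "\<And>t. summable (\<lambda>n. f n t)"
  shows "((\<lambda>t. \<Sum>n. f n t) has_vector_derivative (\<Sum>n. f' n t)) (at t)"
proof -
  let ?g' = "\<lambda>t. \<Sum>n. f' n t"
  have unif: "uniform_limit UNIV (\<lambda>n t. \<Sum>i<n. f' i t) ?g' sequentially"
    using bound \<open>summable M\<close> by (intro Weierstrass_m_test) auto
  have "\<exists>g. \<forall>x\<in>UNIV. (\<lambda>n. f n x) sums g x \<and> (g has_derivative (\<lambda>h. h *\<^sub>R ?g' x)) (at x within UNIV)"
  proof (rule has_derivative_series[where x = t and f' = "\<lambda>n x h. h *\<^sub>R f' n x"])
    show "\<forall>\<^sub>F n in sequentially. \<forall>x\<in>UNIV. \<forall>h.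
        norm ((\<Sum>i<n. h *\<^sub>R f' i x) - h *\<^sub>R ?g' x) \<le> e * norm h" if "0 < e" for e
      using uniform_limitD[OF unif that]
    proof (rule eventually_mono, intro ballI allI)
      fix n x h
      assume "\<forall>x\<in>UNIV. dist (\<Sum>i<n. f' i x) (?g' x) < e"
      then have "norm ((\<Sum>i<n. f' i x) - ?g' x) \<le> e" by (auto simp: dist_norm intro: less_imp_le)
      then have "\<bar>h\<bar> * norm ((\<Sum>i<n. f' i x) - ?g' x) \<le> \<bar>h\<bar> * e"
        by (intro mult_left_mono) auto
      then show "norm ((\<Sum>i<n. h *\<^sub>R f' i x) - h *\<^sub>R ?g' x) \<le> e * norm h"
        by (simp add: scaleR_right.sum[symmetric] scaleR_diff_right[symmetric] mult.commute)
    qed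
  qed (use der assms(4) in \<open>auto simp: has_vector_derivative_def summable_sums\<close>)
  then obtain g where g: "\<And>x. (\<lambda>n. f n x) sums g x"
    "\<And>x. (g has_derivative (\<lambda>h. h *\<^sub>R ?g' x)) (at x)" by auto
  have "g = (\<lambda>t. \<Sum>n. f n t)" using g(1) by (auto simp: sums_iff)
  with g(2) show ?thesis by (simp add: has_vector_derivative_def)
qed

definition osc_op ::
  "nat \<Rightarrow> (int \<Rightarrow> complex ^ 'n ^ 'n) \<Rightarrow> real \<Rightarrow> complex ^ 'n \<Rightarrow> complex ^ 'n" where
  "osc_op m B \<tau> v = (\<Sum>l\<in>osc_indices m. exp (\<i> * of_int l * of_real \<tau>) *s (B l *v v))"

definition forcing :: "nat \<Rightarrow> (int \<Rightarrow> complex ^ 'n) \<Rightarrow> real \<Rightarrow> complex ^ 'n" where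
  "forcing m d \<tau> = (\<Sum>l\<in>osc_indices m. exp (\<i> * of_int l * of_real \<tau>) *s d l) + d 0"

lemma bounded_linear_osc_op: "bounded_linear (osc_op m B \<tau>)"
  for B :: "int \<Rightarrow> complex ^ ('n::finite) ^ 'n"
  unfolding osc_op_def[abs_def]
  by (intro bounded_linear_sum
      bounded_linear_compose[OF bounded_linear_scale_right matrix_vector_mul_bounded_linear])

lemma scaleR_matrix_mult: "(c *\<^sub>R A) *v v = c *\<^sub>R (A *v v)" for A :: "complex ^ ('n::finite) ^ 'n"
  by (simp add: vec_eq_iff matrix_vector_mult_def scaleR_sum_right)

lemma matrix_mult_scaleR: "A *v (c *\<^sub>R v) = c *\<^sub>R (A *v v)" for A :: "complex ^ ('n::finite) ^ 'n"
  by (rule linear_cmul[OF matrix_vector_mul_linear])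

lemma osc_rhs_eq:
  "osc_rhs m A0 B d \<omega> t v =
    A0 *v v + (1 / \<omega>) *\<^sub>R (B 0 *v v) + osc_op m B (\<omega> * t) v + forcing m d (\<omega> * t)"
  by (simp add: osc_rhs_def osc_op_def forcing_def matrix_vector_mult_add_rdistrib
      scaleR_matrix_mult vec.scale_right_distrib sum.distrib mult.assoc)

lemma trig_forcing:
  assumes "m \<le> N"
  shows "trig N (\<lambda>l. if \<bar>l\<bar> \<le> int m then d l else 0) \<tau> = forcing m d \<tau>"
proof -
  have "trig N (\<lambda>l. if \<bar>l\<bar> \<le> int m then d l else 0) \<tau>
      = (\<Sum>l\<in>insert 0 (osc_indices m). exp (\<i> * of_int l * of_real \<tau>) *s d l)"
    unfolding trig_def using assms by (intro sum.mono_neutral_cong_right) (auto simp: osc_indices_def)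
  also have "\<dots> = forcing m d \<tau>"
    using finite_osc_indices by (simp add: forcing_def osc_indices_def add.commute)
  finally show ?thesis .
qed

context averaged_recursion
begin

definition wfun :: "nat \<Rightarrow> real \<Rightarrow> complex ^ 'n" where
  "wfun k = trig (m * k) (wcoef k)"

lemma wfun_eq: "wfun k \<tau> = cvec k + trig (m * k) (ycoef k) \<tau>"
proof -
  have "trig (m * k) (\<lambda>l. if l = 0 then cvec k else 0) \<tau>
      = (\<Sum>l\<in>{- int (m * k)..int (m * k)}. if l = 0 then cvec k else 0)"
    unfolding trig_def by (intro sum.cong) auto
  then have "trig (m * k) (\<lambda>l. if l = 0 then cvec k else 0) \<tau> = cvec k"
    by (simp add: sum.delta')
  moreover have "wcoef k = (\<lambda>l. ycoef k l + (if l = 0 then cvec k else 0))"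
    by (simp add: wcoef_def fun_eq_iff)
  ultimately show ?thesis by (simp add: wfun_def trig_add)
qed

lemma wcoef_support: "int (m * k) < \<bar>l\<bar> \<Longrightarrow> wcoef k l = 0"
  using ycoef_support[of k l] by (auto simp: wcoef_def simp del: of_nat_mult)

text \<open>The derivative of \<open>wfun (Suc k)\<close>, see \<open>wfun_has_vector_derivative\<close> below.\<close>

definition wslope :: "nat \<Rightarrow> real \<Rightarrow> complex ^ 'n" where
  "wslope k \<tau> = A0 *v wfun k \<tau> + osc_op m B \<tau> (wfun k \<tau>)
     + B 0 *v (if k = 0 then 0 else wfun (k - 1) \<tau>) + (if k = 1 then forcing m d \<tau> else 0)"

text \<open>The number \<open>2mk + 1\<close> of frequencies is at most \<open>(2m + 1) 2^k\<close>, so the function \<open>w\<^sub>k\<close> still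
  grows geometrically, at twice the rate of its coefficients.\<close>

lemma wfun_bound:
  obtains C S where "0 \<le> C" "1 \<le> S" "\<And>k \<tau>. norm (wfun k \<tau>) \<le> C * S ^ k"
proof -
  obtain R where R: "1 \<le> R" "\<And>k l. norm (ycoef k l) \<le> R ^ k" "\<And>k. norm (cvec k) \<le> R ^ (k + 1)"
    using coefficients_geometric by blast
  let ?C = "(2 * real m + 1) * (2 * R)"
  have "norm (wfun k \<tau>) \<le> ?C * (2 * R) ^ k" for k \<tau>
  proof -
    have "norm (wcoef k l) \<le> 2 * R * R ^ k" for l
    proof -
      have "norm (wcoef k l) \<le> R ^ k + R ^ (k + 1)"
        unfolding wcoef_def using R by (intro norm_triangle_mono) auto
      moreover have "R ^ k \<le> R ^ (k + 1)" using R(1) by (intro power_increasing) auto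
      ultimately show ?thesis by simp
    qed
    then have "norm (wfun k \<tau>) \<le> (2 * real (m * k) + 1) * (2 * R * R ^ k)"
      unfolding wfun_def by (rule norm_trig_le)
    also have "\<dots> \<le> ((2 * real m + 1) * 2 ^ k) * (2 * R * R ^ k)"
    proof (rule mult_right_mono)
      have k: "1 + real k \<le> 2 ^ k" using Bernoulli_inequality[of 1 k] by simp
      have "2 * real (m * k) + 1 \<le> (2 * real m + 1) * (1 + real k)"
        by (simp add: algebra_simps)
      also have "\<dots> \<le> (2 * real m + 1) * 2 ^ k"
        using k by (intro mult_left_mono) auto
      finally show "2 * real (m * k) + 1 \<le> (2 * real m + 1) * 2 ^ k" .
    qed (use R(1) in simp)
    finally show ?thesis by (simp add: power_mult_distrib algebra_simps)
  qed
  with R(1) show thesis by (intro that[of ?C "2 * R"]) auto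
qed

lemma wslope_bound:
  assumes C: "0 \<le> C" and S: "1 \<le> S" and w: "\<And>k \<tau>. norm (wfun k \<tau>) \<le> C * S ^ k"
  obtains C' where "0 \<le> C'" "\<And>k \<tau>. norm (wslope k \<tau>) \<le> C' * S ^ k"
proof -
  obtain K where K1: "1 \<le> K" and A0: "\<And>v. norm (A0 *v v) \<le> K * norm v"
    and B: "\<And>l v. \<bar>l\<bar> \<le> int m \<Longrightarrow> norm (B l *v v) \<le> K * norm v"
    and d: "\<And>l. \<bar>l\<bar> \<le> int m \<Longrightarrow> norm (d l) \<le> K"
    by (rule coefficient_bounds) (rule that)
  let ?c = "real (card (osc_indices m))"
  have osc: "\<bar>l\<bar> \<le> int m" if "l \<in> osc_indices m" for l
    using that by (simp add: osc_indices_def)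
  have mono: "K * x \<le> K * b" if "x \<le> b" for x b using that K1 by simp
  have "norm (wslope k \<tau>) \<le> (2 * K * C + ?c * (K * C) + ?c * K + K) * S ^ k" for k \<tau>
  proof -
    have 1: "norm (A0 *v wfun k \<tau>) \<le> K * (C * S ^ k)"
      by (rule order_trans[OF A0 mono[OF w]])
    have 2: "norm (osc_op m B \<tau> (wfun k \<tau>)) \<le> ?c * (K * (C * S ^ k))"
      unfolding osc_op_def using order_trans[OF B mono[OF w]] osc
      by (intro norm_sum_osc_le) (simp add: norm_vector_scale norm_exp_osc)
    have 3: "norm (B 0 *v (if k = 0 then 0 else wfun (k - 1) \<tau>)) \<le> K * (C * S ^ k)"
    proof (rule order_trans[OF B mono])
      have "C * S ^ (k - 1) \<le> C * S ^ k" using S C by (intro mult_left_mono power_increasing) auto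
      then show "norm (if k = 0 then 0 else wfun (k - 1) \<tau>) \<le> C * S ^ k"
        using order_trans[OF w[of "k - 1" \<tau>]] C S by auto
    qed simp
    have "norm (\<Sum>l\<in>osc_indices m. exp (\<i> * of_int l * of_real \<tau>) *s d l) \<le> ?c * K"
      using d osc by (intro norm_sum_osc_le) (simp add: norm_vector_scale norm_exp_osc)
    then have "norm (forcing m d \<tau>) \<le> ?c * K + K"
      unfolding forcing_def using d[of 0] by (intro norm_triangle_mono) auto
    moreover have "(?c * K + K) * 1 \<le> (?c * K + K) * S ^ k"
      using S K1 by (intro mult_left_mono) auto
    ultimately have 4: "norm (if k = 1 then forcing m d \<tau> else 0) \<le> (?c * K + K) * S ^ k"
      using K1 S by auto
    have "norm (wslope k \<tau>) \<le> K * (C * S ^ k) + ?c * (K * (C * S ^ k)) + K * (C * S ^ k)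
        + (?c * K + K) * S ^ k"
      unfolding wslope_def by (intro norm_triangle_mono 1 2 3 4)
    then show ?thesis by (simp add: algebra_simps)
  qed
  moreover have "0 \<le> 2 * K * C + ?c * (K * C) + ?c * K + K" using K1 C by simp
  ultimately show thesis using that by blast
qed

definition solution :: "real \<Rightarrow> real \<Rightarrow> complex ^ 'n" where
  "solution \<omega> t = \<omega> *\<^sub>R (\<Sum>k. (1 / \<omega> ^ k) *\<^sub>R wfun k (\<omega> * t))"

end

context averaged_system
begin

lemma wfun_has_vector_derivative:
  "(wfun (Suc k) has_vector_derivative wslope k \<tau>) (at \<tau>)"
proof -
  let ?N = "m * Suc k"
  have supp: "wcoef i l = 0" if "int (m * i) < \<bar>l\<bar>" for i l by (rule wcoef_support[OF that])
  have "trig ?N (\<lambda>l. (\<i> * of_int l) *s wcoef (Suc k) l) \<tau>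
    = A0 *v trig ?N (wcoef k) \<tau>
     + (\<Sum>j\<in>osc_indices m. B j *v trig ?N (\<lambda>l. wcoef k (l - j)) \<tau>)
     + B 0 *v trig ?N (\<lambda>l. if k = 0 then 0 else wcoef (k - 1) l) \<tau>
     + trig ?N (\<lambda>l. if k = 1 \<and> \<bar>l\<bar> \<le> int m then d l else 0) \<tau>"
    unfolding wcoef_recursion trig_add trig_mult trig_sum by (rule refl)
  also have "trig ?N (wcoef k) \<tau> = wfun k \<tau>"
    unfolding wfun_def by (rule trig_extend[OF supp]) auto
  also have "(\<Sum>j\<in>osc_indices m. B j *v trig ?N (\<lambda>l. wcoef k (l - j)) \<tau>) = osc_op m B \<tau> (wfun k \<tau>)"
    unfolding osc_op_def
  proof (intro sum.cong refl)
    fix j assume "j \<in> osc_indices m"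
    then have "int (m * k) + \<bar>j\<bar> \<le> int ?N" by (simp add: osc_indices_def algebra_simps)
    then have "trig ?N (\<lambda>l. wcoef k (l - j)) \<tau> = exp (\<i> * of_int j * of_real \<tau>) *s wfun k \<tau>"
      unfolding wfun_def by (intro trig_shift supp)
    then show "B j *v trig ?N (\<lambda>l. wcoef k (l - j)) \<tau>
        = exp (\<i> * of_int j * of_real \<tau>) *s (B j *v wfun k \<tau>)" by (simp add: vec.scale)
  qed
  also have "trig ?N (\<lambda>l. if k = 0 then 0 else wcoef (k - 1) l) \<tau>
      = (if k = 0 then 0 else wfun (k - 1) \<tau>)"
  proof (cases "k = 0")
    case False
    have "m * (k - 1) \<le> ?N" by (intro mult_le_mono) auto
    then have "trig ?N (wcoef (k - 1)) \<tau> = wfun (k - 1) \<tau>"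
      unfolding wfun_def by (intro trig_extend supp)
    then show ?thesis using False by simp
  qed (simp add: trig_def)
  also have "trig ?N (\<lambda>l. if k = 1 \<and> \<bar>l\<bar> \<le> int m then d l else 0) \<tau>
      = (if k = 1 then forcing m d \<tau> else 0)"
  proof (cases "k = 1")
    case True
    then show ?thesis using trig_forcing[of m ?N d \<tau>] by simp
  qed (simp add: trig_def)
  finally show ?thesis
    using trig_has_vector_derivative[of ?N "wcoef (Suc k)" \<tau> UNIV] by (simp add: wfun_def wslope_def)
qed

text \<open>Multiplying the equation for \<open>w\<^sub>k\<^sub>+\<^sub>1'\<close> by \<open>\<omega>^(-k)\<close> and summing over \<open>k\<close> yields the system for \<open>x/\<omega>\<close>: the shift from
  \<open>w\<^sub>k\<close> to \<open>w\<^sub>k\<^sub>-\<^sub>1\<close> in the \<open>B 0\<close> term yields the factor \<open>1/\<omega>\<close>, and the factor \<open>\<omega>\<close> of the chain rule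
  absorbs the shift on the left.\<close>

lemma solution_is_periodic_solution:
  assumes C: "0 \<le> C" and S: "1 \<le> S" and w: "\<And>k \<tau>. norm (wfun k \<tau>) \<le> C * S ^ k"
    and \<omega>: "S < \<omega>"
  shows "is_periodic_solution m A0 B d \<omega> (solution \<omega>)"
proof -
  have pos: "0 < \<omega>" using S \<omega> by linarith
  have geo: "summable (\<lambda>k. (S / \<omega>) ^ k)"
    using S \<omega> pos by (intro summable_geometric) auto
  obtain C' where C': "0 \<le> C'" "\<And>k \<tau>. norm (wslope k \<tau>) \<le> C' * S ^ k"
    using wslope_bound[OF C S w] by blast
  define f where "f = (\<lambda>k t. (1 / \<omega> ^ k) *\<^sub>R wfun k (\<omega> * t))"
  define f' where "f' = (\<lambda>k t. case k of 0 \<Rightarrow> 0 | Suc i \<Rightarrow> (1 / \<omega> ^ i) *\<^sub>R wslope i (\<omega> * t))"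
  define W where "W = (\<lambda>t. \<Sum>k. f k t)"
  have "norm (f k t) \<le> C * (S / \<omega>) ^ k" for k t
    using divide_right_mono[OF w[of k "\<omega> * t"], of "\<omega> ^ k"] pos
    by (simp add: f_def power_divide)
  then have sumf: "summable (\<lambda>k. f k t)" for t
    by (intro summable_comparison_test'[OF summable_mult[OF geo]])
  have der: "(f k has_vector_derivative f' k t) (at t)" for k t
  proof (cases k)
    case 0
    then have "f k = (\<lambda>t. cvec 0)" by (auto simp: f_def wfun_eq trig_def ycoef_0)
    then show ?thesis using 0 by (simp add: f'_def)
  next
    case (Suc i)
    have "((\<lambda>t. \<omega> * t) has_vector_derivative \<omega>) (at t)"
      by (auto intro!: derivative_eq_intros simp: has_real_derivative_iff_has_vector_derivative[symmetric])
    from vector_diff_chain_at[OF this wfun_has_vector_derivative[of i "\<omega> * t"]]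
    have "((\<lambda>t. (1 / \<omega> ^ k) *\<^sub>R wfun (Suc i) (\<omega> * t)) has_vector_derivative
      (1 / \<omega> ^ k) *\<^sub>R (\<omega> *\<^sub>R wslope i (\<omega> * t))) (at t)"
      by (intro bounded_linear.has_vector_derivative[OF bounded_linear_scaleR_right]) (simp add: o_def)
    then show ?thesis using pos by (simp add: f_def f'_def Suc)
  qed
  have bd: "norm (f' k t) \<le> C' * \<omega> * (S / \<omega>) ^ k" for k t
  proof (cases k)
    case (Suc i)
    have "norm (f' k t) \<le> C' * S ^ i / \<omega> ^ i"
      using divide_right_mono[OF C'(2)[of i "\<omega> * t"], of "\<omega> ^ i"] pos by (simp add: f'_def Suc)
    also have "\<dots> \<le> C' * S ^ Suc i / \<omega> ^ i"
      using S C'(1) pos by (intro divide_right_mono mult_left_mono power_increasing) auto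
    also have "\<dots> = C' * \<omega> * (S / \<omega>) ^ k" using pos by (simp add: Suc power_divide)
    finally show ?thesis .
  qed (use C' pos in \<open>simp add: f'_def\<close>)
  have W': "(W has_vector_derivative (\<Sum>k. f' k t)) (at t)" for t
    unfolding W_def
    by (rule has_vector_derivative_suminf[OF der bd summable_mult[OF geo] sumf])
  have sumsW: "(\<lambda>k. f k t) sums W t" for t
    unfolding W_def by (rule summable_sums[OF sumf])
  have sum_f': "(\<Sum>k. f' k t) = A0 *v W t + osc_op m B (\<omega> * t) (W t)
      + (1 / \<omega>) *\<^sub>R (B 0 *v W t) + (1 / \<omega>) *\<^sub>R forcing m d (\<omega> * t)" for t
  proof -
    note lin = bounded_linear.sums[OF _ sumsW[of t]]
    have prev: "(\<lambda>k. if k = 0 then 0 else (1 / \<omega>) *\<^sub>R (B 0 *v f (k - 1) t))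
        sums ((1 / \<omega>) *\<^sub>R (B 0 *v W t))"
      using sums_Suc[of "\<lambda>k. if k = 0 then 0 else (1 / \<omega>) *\<^sub>R (B 0 *v f (k - 1) t)"
          "(1 / \<omega>) *\<^sub>R (B 0 *v W t)"]
        sums_scaleR_right[OF lin[OF matrix_vector_mul_bounded_linear[of "B 0"]], of "1 / \<omega>"]
      by simp
    have single: "(\<lambda>k. if k = 1 then (1 / \<omega>) *\<^sub>R forcing m d (\<omega> * t) else 0)
        sums ((1 / \<omega>) *\<^sub>R forcing m d (\<omega> * t))"
      using sums_single[of 1 "\<lambda>k. (1 / \<omega>) *\<^sub>R forcing m d (\<omega> * t)"] by simp
    have step: "f' (Suc k) t = A0 *v f k t + osc_op m B (\<omega> * t) (f k t)
        + (if k = 0 then 0 else (1 / \<omega>) *\<^sub>R (B 0 *v f (k - 1) t))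
        + (if k = 1 then (1 / \<omega>) *\<^sub>R forcing m d (\<omega> * t) else 0)" for k
    proof -
      interpret osc: bounded_linear "osc_op m B (\<omega> * t)" by (rule bounded_linear_osc_op)
      have "k = 0 \<or> \<omega> ^ k = \<omega> * \<omega> ^ (k - 1)" by (cases k) auto
      then show ?thesis
        by (auto simp: f'_def f_def wslope_def scaleR_add_right osc.scaleR matrix_mult_scaleR)
    qed
    have "(\<lambda>k. f' (Suc k) t) sums (A0 *v W t + osc_op m B (\<omega> * t) (W t)
      + (1 / \<omega>) *\<^sub>R (B 0 *v W t) + (1 / \<omega>) *\<^sub>R forcing m d (\<omega> * t))"
      unfolding step
      by (intro sums_add lin[OF matrix_vector_mul_bounded_linear] lin[OF bounded_linear_osc_op]
          prev single)
    from sums_Suc[OF this] show ?thesis by (simp add: f'_def sums_iff)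
  qed
  have sol: "solution \<omega> t = \<omega> *\<^sub>R W t" for t
    by (simp add: solution_def W_def f_def)
  have "(solution \<omega> has_vector_derivative osc_rhs m A0 B d \<omega> t (solution \<omega> t)) (at t)" for t
  proof -
    interpret osc: bounded_linear "osc_op m B (\<omega> * t)" by (rule bounded_linear_osc_op)
    have "((\<lambda>t. \<omega> *\<^sub>R W t) has_vector_derivative \<omega> *\<^sub>R (\<Sum>k. f' k t)) (at t)"
      by (rule bounded_linear.has_vector_derivative[OF bounded_linear_scaleR_right W'])
    moreover have "\<omega> *\<^sub>R (\<Sum>k. f' k t) = osc_rhs m A0 B d \<omega> t (\<omega> *\<^sub>R W t)"
      unfolding sum_f' osc_rhs_eq using pos
      by (simp add: scaleR_add_right osc.scaleR matrix_mult_scaleR)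
    ultimately show ?thesis by (simp add: sol[abs_def])
  qed
  moreover have "solution \<omega> (t + 2 * pi / \<omega>) = solution \<omega> t" for t
  proof -
    have "wfun k (\<omega> * (t + 2 * pi / \<omega>)) = wfun k (\<omega> * t)" for k
      using trig_periodic[of "m * k" "wcoef k" "\<omega> * t"] pos by (simp add: wfun_def distrib_left)
    then show ?thesis by (simp add: solution_def)
  qed
  ultimately show ?thesis by (simp add: is_periodic_solution_def)
qed

end

lemma geometric_tail:
  fixes g :: "nat \<Rightarrow> real \<Rightarrow> 'a::banach"
  assumes bound: "\<And>k t. norm (g k t) \<le> K * q ^ k" and q: "0 \<le> q" "q \<le> 1/2"
  shows "summable (\<lambda>k. norm (g k t))"
    and "uniform_limit UNIV (\<lambda>N t. \<Sum>k<N. g k t) (\<lambda>t. \<Sum>k. g k t) sequentially"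
    and "norm ((\<Sum>k. g k t) - (\<Sum>k=0..r. g k t)) \<le> 2 * K * q ^ (r + 1)"
proof -
  have geo: "summable (\<lambda>k. K * q ^ k)"
    using q by (intro summable_mult summable_geometric) auto
  show sn: "summable (\<lambda>k. norm (g k t))" for t
    by (rule summable_comparison_test'[OF geo, of 0]) (simp add: bound)
  show "uniform_limit UNIV (\<lambda>N t. \<Sum>k<N. g k t) (\<lambda>t. \<Sum>k. g k t) sequentially"
    by (rule Weierstrass_m_test[OF _ geo]) (rule bound)
  have K: "0 \<le> K" using order_trans[OF norm_ge_zero bound[of 0 0]] by simp
  have "(\<Sum>k. g k t) - (\<Sum>k=0..r. g k t) = (\<Sum>k. g (k + Suc r) t)"
    using suminf_split_initial_segment[OF summable_norm_cancel[OF sn], of t "Suc r"]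
    by (simp add: lessThan_Suc_atMost atMost_atLeast0)
  also have "norm \<dots> \<le> (\<Sum>k. K * q ^ (k + Suc r))"
    by (rule order_trans[OF summable_norm suminf_le])
       (use sn geo bound in \<open>auto simp: summable_iff_shift[of "\<lambda>k. norm (g k t)" "Suc r"] summable_iff_shift[of "\<lambda>k. K * q ^ k" "Suc r"] simp del: add_Suc_right\<close>)
  also have "\<dots> = K * q ^ Suc r * (1 / (1 - q))"
    using suminf_mult[OF summable_geometric, of q "K * q ^ Suc r"] suminf_geometric[of q] q
    by (simp add: power_add mult_ac)
  also have "\<dots> \<le> K * q ^ Suc r * 2"
    using q K by (intro mult_left_mono) (auto simp: field_simps)
  finally show "norm ((\<Sum>k. g k t) - (\<Sum>k=0..r. g k t)) \<le> 2 * K * q ^ (r + 1)" by simp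
qed

section \<open>Uniqueness of the periodic solution\<close>

text \<open>Average \<open>v t - v u\<close> over \<open>u\<close> in one period and use the mean value inequality.\<close>

lemma zero_mean_bound:
  fixes v :: "real \<Rightarrow> 'a::euclidean_space"
  assumes T: "0 < T"
    and der: "\<And>t. (v has_vector_derivative v' t) (at t)"
    and slope: "\<And>t. t \<in> {t0..t0 + T} \<Longrightarrow> norm (v' t) \<le> L"
    and zero: "integral {t0..t0 + T} v = 0"
    and t: "t \<in> {t0..t0 + T}"
  shows "norm (v t) \<le> T * L"
proof -
  have cont: "continuous_on S v" for S
    by (intro continuous_at_imp_continuous_on ballI has_vector_derivative_continuous[OF der])
  have L: "0 \<le> L" using order_trans[OF norm_ge_zero slope[OF t]] .
  have diff: "norm (v t - v u) \<le> T * L" if "u \<in> {t0..t0 + T}" for u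
  proof -
    have "norm (v t - v u) \<le> L * norm (t - u)"
    proof (rule differentiable_bound[of "{t0..t0 + T}" v "\<lambda>x h. h *\<^sub>R v' x"])
      show "onorm (\<lambda>h. h *\<^sub>R v' x) \<le> L" if "x \<in> {t0..t0 + T}" for x
        by (rule onorm_bound) (use L slope[OF that] in \<open>auto simp: mult.commute[of L] intro: mult_left_mono\<close>)
    qed (use der t that in \<open>auto simp: has_vector_derivative_def intro: has_derivative_at_withinI\<close>)
    also have "\<dots> \<le> L * T"
      using t that L by (intro mult_left_mono) auto
    finally show ?thesis by (simp add: mult.commute)
  qed
  have vint: "(v has_integral 0) {t0..t0 + T}"
    using integrable_continuous_real[OF cont] zero by (metis integrable_integral)
  have "((\<lambda>u. v t - v u) has_integral T *\<^sub>R v t - 0) (cbox t0 (t0 + T))"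
    using has_integral_diff[OF has_integral_const_real[of "v t" t0 "t0 + T"] vint] T by simp
  then have "norm (T *\<^sub>R v t - 0) \<le> (T * L) * measure lborel (cbox t0 (t0 + T))"
    using diff T L by (intro has_integral_bound) auto
  then have "T * norm (v t) \<le> T * (T * L)" using T by (simp add: mult_ac)
  then show ?thesis using T by simp
qed

definition fourier :: "real \<Rightarrow> real \<Rightarrow> (real \<Rightarrow> complex ^ 'n) \<Rightarrow> int \<Rightarrow> complex ^ 'n" where
  "fourier \<omega> t0 v l = integral {t0..t0 + 2 * pi / \<omega>}
     (\<lambda>t. exp (\<i> * of_int (- l) * of_real (\<omega> * t)) *s v t)"

text \<open>Integrate the derivative of \<open>e^(-il\<omega>t) v(t)\<close> over one period; the boundary terms cancel.\<close>

lemma fourier_recursion: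
  fixes v :: "real \<Rightarrow> complex ^ ('n::finite)"
  assumes \<omega>: "0 < \<omega>"
    and der: "\<And>t. (v has_vector_derivative
        A0 *v v t + (1 / \<omega>) *\<^sub>R (B 0 *v v t) + osc_op m B (\<omega> * t) (v t)) (at t)"
    and per: "\<And>t. v (t + 2 * pi / \<omega>) = v t"
  shows "(\<i> * of_int l * of_real \<omega>) *s fourier \<omega> t0 v l =
    A0 *v fourier \<omega> t0 v l + (1 / \<omega>) *\<^sub>R (B 0 *v fourier \<omega> t0 v l)
      + (\<Sum>j\<in>osc_indices m. B j *v fourier \<omega> t0 v (l - j))"
proof -
  define E where "E = (\<lambda>l t. exp (\<i> * of_int l * of_real (\<omega> * t)))"
  define f where "f = (\<lambda>l t. E (- l) t *s v t)"
  define F where "F = fourier \<omega> t0 v"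
  let ?I = "{t0..t0 + 2 * pi / \<omega>}"
  let ?v' = "\<lambda>t. A0 *v v t + (1 / \<omega>) *\<^sub>R (B 0 *v v t) + osc_op m B (\<omega> * t) (v t)"
  have Eder: "(E k has_vector_derivative \<i> * of_int k * of_real \<omega> * E k t) (at t)" for k t
  proof -
    have "((\<lambda>z. exp (\<i> * of_int k * (of_real \<omega> * z))) has_field_derivative
       \<i> * of_int k * of_real \<omega> * exp (\<i> * of_int k * (of_real \<omega> * of_real t))) (at (of_real t))"
      by (auto intro!: derivative_eq_intros)
    from has_vector_derivative_real_field[OF this] show ?thesis by (simp add: E_def)
  qed
  have Eadd: "E k t * E k' t = E (k + k') t" for k k' t
    by (simp add: E_def exp_add[symmetric] algebra_simps)
  have fder: "(f k has_vector_derivative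
      E (- k) t *s ?v' t + (\<i> * of_int (- k) * of_real \<omega> * E (- k) t) *s v t) (at t)" for k t
    unfolding f_def
    by (rule bounded_bilinear.has_vector_derivative[OF bounded_bilinear_scale Eder der])
  have fcont: "continuous_on ?I (f k)" for k
    by (intro continuous_at_imp_continuous_on ballI has_vector_derivative_continuous[OF fder])
  have fint: "(f k has_integral F k) ?I" for k
    using integrable_continuous_real[OF fcont[of k], THEN integrable_integral]
    by (simp add: F_def fourier_def f_def E_def)
  have slope: "E (- k) t *s ?v' t + (\<i> * of_int (- k) * of_real \<omega> * E (- k) t) *s v t
      = A0 *v f k t + (1 / \<omega>) *\<^sub>R (B 0 *v f k t) + (\<Sum>j\<in>osc_indices m. B j *v f (k - j) t)
        - (\<i> * of_int k * of_real \<omega>) *s f k t" for k t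
  proof -
    have "E (- k) t *s osc_op m B (\<omega> * t) (v t) = (\<Sum>j\<in>osc_indices m. (E (- k) t * E j t) *s (B j *v v t))"
      by (simp add: osc_op_def E_def vec.scale_sum_right)
    also have "\<dots> = (\<Sum>j\<in>osc_indices m. B j *v f (k - j) t)"
      by (simp add: Eadd f_def vec.scale)
    moreover have "E (- k) t *s ((1 / \<omega>) *\<^sub>R (B 0 *v v t)) = (1 / \<omega>) *\<^sub>R (E (- k) t *s (B 0 *v v t))"
      by (simp add: vec_eq_iff)
    ultimately show ?thesis
      by (simp add: f_def vec.scale vec.scale_right_distrib mult.assoc)
  qed
  have "((\<lambda>t. A0 *v f l t + (1 / \<omega>) *\<^sub>R (B 0 *v f l t) + (\<Sum>j\<in>osc_indices m. B j *v f (l - j) t)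
        - (\<i> * of_int l * of_real \<omega>) *s f l t) has_integral
      f l (t0 + 2 * pi / \<omega>) - f l t0) ?I"
    using fder[of l] \<omega> unfolding slope
    by (intro fundamental_theorem_of_calculus) (auto intro: has_vector_derivative_at_within)
  moreover have "((\<lambda>t. A0 *v f l t + (1 / \<omega>) *\<^sub>R (B 0 *v f l t) + (\<Sum>j\<in>osc_indices m. B j *v f (l - j) t)
        - (\<i> * of_int l * of_real \<omega>) *s f l t) has_integral
      A0 *v F l + (1 / \<omega>) *\<^sub>R (B 0 *v F l) + (\<Sum>j\<in>osc_indices m. B j *v F (l - j))
        - (\<i> * of_int l * of_real \<omega>) *s F l) ?I"
    using has_integral_linear[OF fint matrix_vector_mul_bounded_linear]
      has_integral_linear[OF fint bounded_linear_scale_right] finite_osc_indices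
    by (intro has_integral_diff has_integral_add has_integral_sum has_integral_cmul)
       (auto simp: o_def)
  ultimately have "A0 *v F l + (1 / \<omega>) *\<^sub>R (B 0 *v F l) + (\<Sum>j\<in>osc_indices m. B j *v F (l - j))
        - (\<i> * of_int l * of_real \<omega>) *s F l = f l (t0 + 2 * pi / \<omega>) - f l t0"
    by (rule has_integral_unique[rotated])
  also have "\<dots> = 0"
    using per[of t0] exp_osc_periodic[of "- l" "\<omega> * t0"] \<omega>
    by (simp add: f_def E_def distrib_left)
  finally show ?thesis by (simp add: F_def)
qed

context averaged_system
begin

text \<open>Approximate inverse.  With \<open>\<phi> u = Q u + P u / \<omega>\<close>, where \<open>Q\<close> is \<open>kernel_part\<close>, the kernel property and the right
  inverse give \<open>(A0 + A1/\<omega>) (\<phi> u) = (u + A1 P u / \<omega>) / \<omega>\<close>, whose norm is at least \<open>|u| / (2\<omega>)\<close>.  Hence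
  \<open>\<phi>\<close> is injective, so every \<open>c\<close> has the form \<open>\<phi> u\<close>, and \<open>|c| \<le> 2K |u|\<close>.\<close>

lemma averaged_matrix_bound:
  assumes K: "1 \<le> K" and A1: "\<And>v. norm (averaged_A1 m B *v v) \<le> K * norm v"
    and P: "\<And>v. norm (P *v v) \<le> K * norm v"
    and Q: "\<And>v. norm (kernel_part v) \<le> K * norm v"
    and \<omega>: "2 * K ^ 2 \<le> \<omega>"
  shows "norm c \<le> 4 * K * \<omega> * norm (A0 *v c + (1 / \<omega>) *\<^sub>R (averaged_A1 m B *v c))"
proof -
  let ?A1 = "averaged_A1 m B"
  have K2: "1 \<le> K ^ 2" using K by simp
  then have pos: "0 < \<omega>" "1 \<le> \<omega>" using \<omega> by auto
  obtain Qm where Qm: "\<And>f. kernel_part f = Qm *v f" using kernel_part_matrix by blast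
  define \<phi> where "\<phi> = (\<lambda>u. (Qm + (1 / \<omega>) *\<^sub>R P) *v u)"
  have \<phi>: "\<phi> u = kernel_part u + (1 / \<omega>) *\<^sub>R (P *v u)" for u
    by (simp add: \<phi>_def Qm matrix_vector_mult_add_rdistrib scaleR_matrix_mult)
  have small: "norm ((1 / \<omega>) *\<^sub>R (?A1 *v (P *v u))) \<le> norm u / 2" for u
  proof -
    have "norm (?A1 *v (P *v u)) \<le> K * (K * norm u)"
      using order_trans[OF A1 mult_left_mono[OF P]] K by simp
    also have "\<dots> \<le> (\<omega> / 2) * norm u"
      using mult_right_mono[OF \<omega>, of "norm u"] by (simp add: power2_eq_square)
    finally show ?thesis using pos by (simp add: field_simps)
  qed
  have L: "A0 *v \<phi> u + (1 / \<omega>) *\<^sub>R (?A1 *v \<phi> u)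
      = (1 / \<omega>) *\<^sub>R (u + (1 / \<omega>) *\<^sub>R (?A1 *v (P *v u)))" for u
  proof -
    have "A0 *v \<phi> u + (1 / \<omega>) *\<^sub>R (?A1 *v \<phi> u)
      = (1 / \<omega>) *\<^sub>R ((A0 *v (P *v u) + ?A1 *v kernel_part u) + (1 / \<omega>) *\<^sub>R (?A1 *v (P *v u)))"
      by (simp add: \<phi> vec.add kernel matrix_mult_scaleR scaleR_add_right)
    then show ?thesis by (simp add: right_inverse)
  qed
  have low: "norm u / (2 * \<omega>) \<le> norm (A0 *v \<phi> u + (1 / \<omega>) *\<^sub>R (?A1 *v \<phi> u))" for u
  proof -
    let ?e = "(1 / \<omega>) *\<^sub>R (?A1 *v (P *v u))"
    have "norm u / 2 \<le> norm (u + ?e)"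
      using norm_triangle_ineq4[of "u + ?e" ?e] small[of u]
      unfolding add_diff_cancel_right' by linarith
    then have "(1 / \<omega>) * (norm u / 2) \<le> (1 / \<omega>) * norm (u + ?e)"
      using pos by (intro mult_left_mono) auto
    then show ?thesis unfolding L norm_scaleR using pos by (simp add: field_simps)
  qed
  have "inj ((*v) (Qm + (1 / \<omega>) *\<^sub>R P))"
  proof (rule vec.linear_inj_iff_eq_0[OF matrix_vector_mul_linear_gen, THEN iffD2], intro allI impI)
    fix u assume "(Qm + (1 / \<omega>) *\<^sub>R P) *v u = 0"
    then have "\<phi> u = 0" by (simp add: \<phi>_def)
    then have "norm u / (2 * \<omega>) \<le> 0" using low[of u] by simp
    then show "u = 0" using pos by (simp add: divide_le_0_iff)
  qed
  then have "surj ((*v) (Qm + (1 / \<omega>) *\<^sub>R P))"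
    by (rule vec.linear_inj_imp_surj[OF matrix_vector_mul_linear_gen])
  then obtain u where u: "c = \<phi> u" unfolding \<phi>_def by (metis surjD)
  have "norm c \<le> K * norm u + 1 * (K * norm u)"
    unfolding u \<phi>
  proof (rule norm_triangle_mono[OF Q])
    show "norm ((1 / \<omega>) *\<^sub>R (P *v u)) \<le> 1 * (K * norm u)"
      unfolding norm_scaleR using pos by (intro mult_mono P) auto
  qed
  also have "\<dots> = 4 * K * \<omega> * (norm u / (2 * \<omega>))" using pos by simp
  also have "\<dots> \<le> 4 * K * \<omega> * norm (A0 *v c + (1 / \<omega>) *\<^sub>R (?A1 *v c))"
    unfolding u using low[of u] K pos by (intro mult_left_mono) auto
  finally show ?thesis .
qed

text \<open>\<open>F\<close> stands for the Fourier coefficients of a periodic solution of the homogeneous system, 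
  which are bounded and satisfy the recursion above.  Dividing by \<open>il\<omega>\<close> shows that \<open>F l = O(|F 0|/\<omega>)\<close> for \<open>l \<noteq> 0\<close>; a second pass gives
  \<open>F l = B\<^sub>l (F 0) / (il\<omega>) + O(|F 0|/\<omega>\<^sup>2)\<close>.  Inserting this in the relation for \<open>l = 0\<close> leaves
  \<open>(A0 + A1/\<omega>) (F 0) = O(|F 0|/\<omega>\<^sup>2)\<close>, too small for \<open>F 0 \<noteq> 0\<close>: with explicit
  constants, \<open>|F 0| \<le> 4K\<omega> \<cdot> 9K^6/\<omega>\<^sup>2 |F 0|\<close>, which explains the threshold \<open>36 K^7\<close>.\<close>

lemma fourier_mean_zero:
  fixes F :: "int \<Rightarrow> complex ^ 'n"
  assumes K: "1 \<le> K" and A0: "\<And>v. norm (A0 *v v) \<le> K * norm v"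
    and B: "\<And>l v. \<bar>l\<bar> \<le> int m \<Longrightarrow> norm (B l *v v) \<le> K * norm v"
    and A1: "\<And>v. norm (averaged_A1 m B *v v) \<le> K * norm v"
    and P: "\<And>v. norm (P *v v) \<le> K * norm v"
    and Q: "\<And>v. norm (kernel_part v) \<le> K * norm v"
    and card: "real (card (osc_indices m)) \<le> K"
    and \<omega>: "36 * K ^ 7 < \<omega>"
    and bdd: "bdd_above (range (\<lambda>l. norm (F l)))"
    and rec: "\<And>l. (\<i> * of_int l * of_real \<omega>) *s F l =
      A0 *v F l + (1 / \<omega>) *\<^sub>R (B 0 *v F l) + (\<Sum>j\<in>osc_indices m. B j *v F (l - j))"
  shows "F 0 = 0"
proof -
  have pw: "K ^ i \<le> K ^ j" if "i \<le> j" for i j using K that by (rule power_increasing[rotated])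
  have K0: "0 \<le> K" using K by simp
  have K7: "1 \<le> K ^ 7" "K ^ 2 \<le> K ^ 7" using pw[of 0 7] pw[of 2 7] by auto
  then have pos: "0 < \<omega>" "1 \<le> \<omega>" "6 * K ^ 2 \<le> \<omega>" "2 * K ^ 2 \<le> \<omega>" using \<omega> by auto
  have osc: "\<bar>l\<bar> \<le> int m" if "l \<in> osc_indices m" for l
    using that by (simp add: osc_indices_def)
  have mono: "K * x \<le> K * b" if "x \<le> b" for x b using that K by simp
  have rhs: "norm (A0 *v u + (1 / \<omega>) *\<^sub>R (B 0 *v u) + (\<Sum>j\<in>osc_indices m. B j *v g j)) \<le> 3 * K ^ 2 * b"
    if u: "norm u \<le> b" and g: "\<And>j. j \<in> osc_indices m \<Longrightarrow> norm (g j) \<le> b" for u g b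
  proof -
    have b: "0 \<le> b" using u norm_ge_zero order_trans by blast
    have 1: "norm (A0 *v u) \<le> K * b" by (rule order_trans[OF A0 mono[OF u]])
    have "norm (B 0 *v u) \<le> K * b" using order_trans[OF B mono[OF u]] by simp
    then have 2: "norm ((1 / \<omega>) *\<^sub>R (B 0 *v u)) \<le> 1 * (K * b)"
      unfolding norm_scaleR using pos by (intro mult_mono) auto
    have "norm (\<Sum>j\<in>osc_indices m. B j *v g j) \<le> real (card (osc_indices m)) * (K * b)"
      using order_trans[OF B mono[OF g]] osc by (intro norm_sum_osc_le) blast
    also have "\<dots> \<le> K * (K * b)" using card K0 b by (intro mult_right_mono) auto
    finally have 3: "norm (\<Sum>j\<in>osc_indices m. B j *v g j) \<le> K * (K * b)" .
    have "K * b \<le> K * (K * b)" using mult_right_mono[OF K, of "K * b"] K0 b by simp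
    with norm_triangle_mono[OF norm_triangle_mono[OF 1 2] 3] show ?thesis
      by (simp add: power2_eq_square)
  qed
  define S where "S = (SUP l. norm (F l))"
  have S: "norm (F l) \<le> S" for l
    unfolding S_def using bdd by (intro cSUP_upper) auto
  have S0: "0 \<le> S" using order_trans[OF norm_ge_zero S] .
  have il: "norm (F l) \<le> b / \<omega>" if "l \<noteq> 0" "norm ((\<i> * of_int l * of_real \<omega>) *s F l) \<le> b" for l b
  proof -
    have "1 * (\<omega> * norm (F l)) \<le> \<bar>real_of_int l\<bar> * (\<omega> * norm (F l))"
      using that pos by (intro mult_right_mono) auto
    also have "\<dots> \<le> b" using that(2) pos by (simp add: norm_vector_scale norm_mult mult_ac)
    finally show ?thesis using pos by (simp add: field_simps)
  qed
  have osc_small: "norm (F l) \<le> 3 * K ^ 2 * S / \<omega>" if "l \<noteq> 0" for l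
    by (rule il[OF that]) (unfold rec, rule rhs, (rule S)+)
  have "3 * K ^ 2 * S / \<omega> \<le> S / 2"
    using mult_right_mono[OF pos(3) S0] pos(1) by (simp add: field_simps)
  then have "norm (F l) \<le> max (norm (F 0)) (S / 2)" for l
    using osc_small[of l] by (cases "l = 0") auto
  then have "S \<le> max (norm (F 0)) (S / 2)" unfolding S_def by (intro cSUP_least) auto
  then have S_le: "S \<le> norm (F 0)" using S0 by (auto simp: max_def split: if_splits)
  let ?c = "F 0"
  let ?b = "3 * K ^ 2 * norm ?c / \<omega>"
  have F1: "norm (F l) \<le> ?b" if "l \<noteq> 0" for l
    using osc_small[OF that] divide_right_mono[OF mult_left_mono[OF S_le, of "3 * K ^ 2"], of \<omega>] pos
    by simp
  \<comment> \<open>remainder of the first-order approximation of \<open>F l\<close>\<close>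
  define \<rho> where "\<rho> = (\<lambda>l. F l - (1 / (\<i> * of_int l * of_real \<omega>)) *s (B l *v ?c))"
  have \<rho>: "norm (\<rho> l) \<le> 3 * K ^ 2 * ?b / \<omega>" if l: "l \<in> osc_indices m" for l
  proof -
    have l0: "l \<noteq> 0" using l by (auto simp: osc_indices_def)
    let ?g = "\<lambda>j. if j = l then 0 else F (l - j)"
    have "(\<Sum>j\<in>osc_indices m. B j *v F (l - j))
        = (\<Sum>j\<in>osc_indices m. B j *v ?g j + (if l = j then B j *v ?c else 0))"
      by (intro sum.cong) auto
    also have "\<dots> = (\<Sum>j\<in>osc_indices m. B j *v ?g j) + B l *v ?c"
      using l by (simp add: sum.distrib sum.delta finite_osc_indices)
    finally have "(\<i> * of_int l * of_real \<omega>) *s F l - B l *v ?c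
        = A0 *v F l + (1 / \<omega>) *\<^sub>R (B 0 *v F l) + (\<Sum>j\<in>osc_indices m. B j *v ?g j)"
      unfolding rec by simp
    moreover have "norm \<dots> \<le> 3 * K ^ 2 * ?b"
      using F1 l0 K0 pos by (intro rhs) auto
    moreover have "\<rho> l = (1 / (\<i> * of_int l * of_real \<omega>)) *s
        ((\<i> * of_int l * of_real \<omega>) *s F l - B l *v ?c)"
      using l0 pos by (simp add: \<rho>_def vec.scale_right_diff_distrib)
    moreover have "norm (1 / (\<i> * of_int l * of_real \<omega>)) \<le> 1 / \<omega>"
    proof -
      have "norm (1 / (\<i> * of_int l * of_real \<omega>)) = norm (1 / (\<i> * of_int l)) * (1 / \<omega>)"
        using pos by (simp add: norm_divide norm_mult)
      also have "\<dots> \<le> 1 * (1 / \<omega>)"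
        using pos by (intro mult_right_mono norm_inverse_il) auto
      finally show ?thesis by simp
    qed
    ultimately have "norm (\<rho> l) \<le> 1 / \<omega> * (3 * K ^ 2 * ?b)"
      unfolding norm_vector_scale using pos by (simp only: norm_vector_scale) (intro mult_mono; simp)
    then show ?thesis by simp
  qed
  have neg: "- j \<in> osc_indices m \<longleftrightarrow> j \<in> osc_indices m" for j
    by (auto simp: osc_indices_def)
  have "(\<Sum>j\<in>osc_indices m. B j *v F (- j))
      = (\<Sum>j\<in>osc_indices m. B (- j) *v F j)"
    using sum.reindex_bij_betw[OF osc_indices_uminus[of m], of "\<lambda>j. B (- j) *v F j"] by simp
  also have "\<dots> = (\<Sum>j\<in>osc_indices m. (1 / \<omega>) *\<^sub>R ((1 / (\<i> * of_int j)) *s (B (- j) *v (B j *v ?c))))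
      + (\<Sum>j\<in>osc_indices m. B (- j) *v \<rho> j)"
    unfolding sum.distrib[symmetric]
    by (intro sum.cong refl)
       (simp add: \<rho>_def vec.diff vec.scale vec_eq_iff scaleR_conv_of_real[where 'a = complex])
  also have "(\<Sum>j\<in>osc_indices m. (1 / \<omega>) *\<^sub>R ((1 / (\<i> * of_int j)) *s (B (- j) *v (B j *v ?c))))
      = (1 / \<omega>) *\<^sub>R (averaged_A1 m B *v ?c) - (1 / \<omega>) *\<^sub>R (B 0 *v ?c)"
    by (simp add: averaged_A1_mult scaleR_sum_right[symmetric] scaleR_add_right)
  finally have "A0 *v ?c + (1 / \<omega>) *\<^sub>R (averaged_A1 m B *v ?c)
      = - (\<Sum>j\<in>osc_indices m. B (- j) *v \<rho> j)"
    using rec[of 0] by (simp add: algebra_simps add_eq_0_iff2)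
  moreover have "norm (\<Sum>j\<in>osc_indices m. B (- j) *v \<rho> j)
      \<le> real (card (osc_indices m)) * (K * (3 * K ^ 2 * ?b / \<omega>))"
    using order_trans[OF B mono[OF \<rho>]] osc by (intro norm_sum_osc_le) auto
  moreover have "real (card (osc_indices m)) * (K * (3 * K ^ 2 * ?b / \<omega>))
      \<le> K * (K * (3 * K ^ 2 * ?b / \<omega>))"
    using card K0 pos by (intro mult_right_mono) auto
  ultimately have "norm (A0 *v ?c + (1 / \<omega>) *\<^sub>R (averaged_A1 m B *v ?c))
      \<le> 9 * K ^ 6 * norm ?c / \<omega> ^ 2"
    by (simp add: eval_nat_numeral mult_ac)
  then have "4 * K * \<omega> * norm (A0 *v ?c + (1 / \<omega>) *\<^sub>R (averaged_A1 m B *v ?c))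
      \<le> 4 * K * \<omega> * (9 * K ^ 6 * norm ?c / \<omega> ^ 2)"
    using K0 pos by (intro mult_left_mono) auto
  also have "\<dots> = 36 * K ^ 7 / \<omega> * norm ?c"
    using pos by (simp add: eval_nat_numeral mult_ac)
  finally have "norm ?c \<le> 36 * K ^ 7 / \<omega> * norm ?c"
    using averaged_matrix_bound[OF K A1 P Q pos(4), of ?c] by simp
  moreover have "36 * K ^ 7 / \<omega> * norm ?c < 1 * norm ?c" if "?c \<noteq> 0"
    using that \<omega> pos by (intro mult_strict_right_mono) auto
  ultimately show ?thesis by force
qed

text \<open>Everything takes place on an arbitrary period starting at \<open>t0\<close>, so that \<open>v t0 = 0\<close> follows without
  transporting \<open>v\<close> to a fixed period.\<close>

lemma homogeneous_solution_zero:
  "\<exists>\<Omega>. \<forall>\<omega>>\<Omega>. \<forall>v.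
    (\<forall>t. (v has_vector_derivative
        A0 *v v t + (1 / \<omega>) *\<^sub>R (B 0 *v v t) + osc_op m B (\<omega> * t) (v t)) (at t)) \<longrightarrow>
    (\<forall>t. v (t + 2 * pi / \<omega>) = v t) \<longrightarrow> (\<forall>t. v t = 0)"
proof -
  obtain K where K: "1 \<le> K" and A0: "\<And>v. norm (A0 *v v) \<le> K * norm v"
    and B: "\<And>l v. \<bar>l\<bar> \<le> int m \<Longrightarrow> norm (B l *v v) \<le> K * norm v"
    and A1: "\<And>v. norm (averaged_A1 m B *v v) \<le> K * norm v"
    and P: "\<And>v. norm (P *v v) \<le> K * norm v"
    and Q: "\<And>v. norm (kernel_part v) \<le> K * norm v"
    and card: "real (card (osc_indices m)) \<le> K"
    by (rule coefficient_bounds) (rule that)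
  have zero: "v t0 = 0"
    if \<omega>: "36 * K ^ 7 < \<omega>"
      and der: "\<And>t. (v has_vector_derivative
        A0 *v v t + (1 / \<omega>) *\<^sub>R (B 0 *v v t) + osc_op m B (\<omega> * t) (v t)) (at t)"
      and per: "\<And>t. v (t + 2 * pi / \<omega>) = v t" for \<omega> v t0
  proof -
    have "1 \<le> K ^ 7" "K ^ 2 \<le> K ^ 7" using K power_increasing[of 2 7 K] by auto
    then have pos: "0 < \<omega>" "1 \<le> \<omega>" "36 * K ^ 2 < \<omega>" using \<omega> by auto
    define T where "T = 2 * pi / \<omega>"
    have T: "0 < T" using pos by (simp add: T_def)
    have cont: "continuous_on X v" for X
      by (intro continuous_at_imp_continuous_on ballI has_vector_derivative_continuous[OF der])
    obtain tm where tm: "tm \<in> {t0..t0 + T}" "\<And>t. t \<in> {t0..t0 + T} \<Longrightarrow> norm (v t) \<le> norm (v tm)"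
      using continuous_attains_sup[of "{t0..t0 + T}" "\<lambda>t. norm (v t)"] T
        continuous_on_norm[OF cont] by auto
    let ?M = "norm (v tm)"
    have "norm (fourier \<omega> t0 v l) \<le> ?M * T" for l
    proof -
      have c: "continuous_on {t0..t0 + T} (\<lambda>t. exp (\<i> * of_int (- l) * of_real (\<omega> * t)) *s v t)"
        by (intro bounded_bilinear.continuous_on[OF bounded_bilinear_scale] cont continuous_intros)
      have "((\<lambda>t. exp (\<i> * of_int (- l) * of_real (\<omega> * t)) *s v t) has_integral fourier \<omega> t0 v l)
          (cbox t0 (t0 + T))"
        using integrable_continuous_real[OF c, THEN integrable_integral]
        by (simp add: fourier_def T_def)
      then have "norm (fourier \<omega> t0 v l) \<le> ?M * measure lborel (cbox t0 (t0 + T))"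
        using tm(2) by (intro has_integral_bound)
          (auto simp del: of_int_minus of_real_mult simp: norm_vector_scale norm_exp_osc)
      then show ?thesis using T by simp
    qed
    then have "bdd_above (range (\<lambda>l. norm (fourier \<omega> t0 v l)))"
      by (intro bdd_aboveI[of _ "?M * T"]) auto
    from fourier_mean_zero[OF K A0 B A1 P Q card \<omega> this fourier_recursion[OF pos(1) der per]]
    have mean0: "integral {t0..t0 + T} v = 0" by (simp add: fourier_def T_def)
    have slope: "norm (A0 *v v t + (1 / \<omega>) *\<^sub>R (B 0 *v v t) + osc_op m B (\<omega> * t) (v t)) \<le> 3 * K ^ 2 * ?M"
      if t: "t \<in> {t0..t0 + T}" for t
    proof -
      have mono: "K * norm (v t) \<le> K * ?M" using tm(2)[OF t] K by simp
      have 1: "norm (A0 *v v t) \<le> K * ?M" by (rule order_trans[OF A0 mono])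
      have Bv: "norm (B l *v v t) \<le> K * ?M" if "\<bar>l\<bar> \<le> int m" for l
        by (rule order_trans[OF B[OF that] mono])
      have 2: "norm ((1 / \<omega>) *\<^sub>R (B 0 *v v t)) \<le> 1 * (K * ?M)"
        unfolding norm_scaleR using pos Bv[of 0] by (intro mult_mono) auto
      have "norm (osc_op m B (\<omega> * t) (v t)) \<le> real (card (osc_indices m)) * (K * ?M)"
        unfolding osc_op_def using Bv
        by (intro norm_sum_osc_le)
           (simp add: norm_vector_scale norm_exp_osc osc_indices_def del: of_real_mult)
      also have "\<dots> \<le> K * (K * ?M)" using card K by (intro mult_right_mono) auto
      finally have 3: "norm (osc_op m B (\<omega> * t) (v t)) \<le> K * (K * ?M)" .
      have "K * ?M \<le> K * (K * ?M)" using mult_right_mono[OF K, of "K * ?M"] K by simp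
      with norm_triangle_mono[OF norm_triangle_mono[OF 1 2] 3] show ?thesis
        by (simp add: power2_eq_square)
    qed
    have "?M \<le> T * (3 * K ^ 2 * ?M)"
      by (rule zero_mean_bound[OF T der slope mean0 tm(1)])
    then have "?M * \<omega> \<le> 6 * pi * K ^ 2 * ?M" using pos by (simp add: T_def field_simps)
    also have "\<dots> \<le> 36 * K ^ 2 * ?M"
      using pi_less_4 by (intro mult_right_mono) auto
    finally have "?M * \<omega> \<le> ?M * (36 * K ^ 2)" by (simp add: mult.commute)
    then have "?M = 0" using pos(3) by (simp add: mult_le_cancel_left)
    then show "v t0 = 0" using tm(2)[of t0] T by simp
  qed
  show ?thesis
  proof (intro exI[of _ "36 * K ^ 7"] allI impI)
    fix \<omega> t and v :: "real \<Rightarrow> complex ^ 'n"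
    assume "36 * K ^ 7 < \<omega>"
      "\<forall>t. (v has_vector_derivative
        A0 *v v t + (1 / \<omega>) *\<^sub>R (B 0 *v v t) + osc_op m B (\<omega> * t) (v t)) (at t)"
      "\<forall>t. v (t + 2 * pi / \<omega>) = v t"
    then show "v t = 0" using zero[of \<omega> v t] by simp
  qed
qed

end

section \<open>The expansion theorem\<close>

context averaged_system
begin

lemma periodic_solution_expansion:
  "\<exists>M0. \<forall>\<^sub>F \<omega> in at_top. \<exists>X. is_periodic_solution m A0 B d \<omega> X \<and>
     (\<forall>Z. is_periodic_solution m A0 B d \<omega> Z \<longrightarrow> Z = X) \<and>
     (\<forall>t. summable (\<lambda>k. norm ((1 / \<omega> ^ k) *\<^sub>R wfun (Suc k) (\<omega> * t)))) \<and>
     uniform_limit UNIV (\<lambda>N t. \<omega> *\<^sub>R cvec 0 + (\<Sum>k<N. (1 / \<omega> ^ k) *\<^sub>R wfun (Suc k) (\<omega> * t))) X sequentially \<and>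
     (\<forall>t r. norm (X t - \<omega> *\<^sub>R cvec 0 - (\<Sum>k=0..r. (1 / \<omega> ^ k) *\<^sub>R wfun (Suc k) (\<omega> * t)))
        \<le> M0 ^ (r + 1) / \<omega> ^ (r + 1))"
proof -
  obtain C S where C: "0 \<le> C" and S: "1 \<le> S" and w: "\<And>k \<tau>. norm (wfun k \<tau>) \<le> C * S ^ k"
    using wfun_bound by blast
  obtain \<Omega> where \<Omega>: "\<forall>\<omega>>\<Omega>. \<forall>v.
    (\<forall>t. (v has_vector_derivative
        A0 *v v t + (1 / \<omega>) *\<^sub>R (B 0 *v v t) + osc_op m B (\<omega> * t) (v t)) (at t)) \<longrightarrow>
    (\<forall>t. v (t + 2 * pi / \<omega>) = v t) \<longrightarrow> (\<forall>t. v t = 0)"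
    using homogeneous_solution_zero by (elim exE)
  \<comment> \<open>the maximum with 1 turns the constant factor of the remainder into an \<open>(r + 1)\<close>-st power\<close>
  define M0 where "M0 = max 1 (2 * (C * S)) * S"
  have main: "\<exists>X. is_periodic_solution m A0 B d \<omega> X \<and>
     (\<forall>Z. is_periodic_solution m A0 B d \<omega> Z \<longrightarrow> Z = X) \<and>
     (\<forall>t. summable (\<lambda>k. norm ((1 / \<omega> ^ k) *\<^sub>R wfun (Suc k) (\<omega> * t)))) \<and>
     uniform_limit UNIV (\<lambda>N t. \<omega> *\<^sub>R cvec 0 + (\<Sum>k<N. (1 / \<omega> ^ k) *\<^sub>R wfun (Suc k) (\<omega> * t))) X sequentially \<and>
     (\<forall>t r. norm (X t - \<omega> *\<^sub>R cvec 0 - (\<Sum>k=0..r. (1 / \<omega> ^ k) *\<^sub>R wfun (Suc k) (\<omega> * t)))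
        \<le> M0 ^ (r + 1) / \<omega> ^ (r + 1))"
    if \<omega>: "2 * S < \<omega>" "\<Omega> < \<omega>" for \<omega>
  proof -
    have pos: "0 < \<omega>" and S\<omega>: "S < \<omega>" using \<omega>(1) S by auto
    define g where "g = (\<lambda>k t. (1 / \<omega> ^ k) *\<^sub>R wfun (Suc k) (\<omega> * t))"
    have g: "norm (g k t) \<le> (C * S) * (S / \<omega>) ^ k" for k t
      using divide_right_mono[OF w[of "Suc k" "\<omega> * t"], of "\<omega> ^ k"] pos
      by (simp add: g_def power_divide mult_ac)
    have q: "0 \<le> S / \<omega>" "S / \<omega> \<le> 1 / 2" using S pos \<omega>(1) by (auto simp: field_simps)
    note tail = geometric_tail[of g "C * S" "S / \<omega>", OF g q]
    let ?X = "solution \<omega>"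
    have X: "is_periodic_solution m A0 B d \<omega> ?X"
      by (rule solution_is_periodic_solution[OF C S w S\<omega>])
    have X_eq: "?X t = \<omega> *\<^sub>R cvec 0 + (\<Sum>k. g k t)" for t
    proof -
      have eq: "(1 / \<omega> ^ Suc k) *\<^sub>R wfun (Suc k) (\<omega> * t) = (1 / \<omega>) *\<^sub>R g k t" for k
        by (simp add: g_def)
      have sg: "summable (\<lambda>k. g k t)" by (rule summable_norm_cancel[OF tail(1)])
      have "summable (\<lambda>k. (1 / \<omega> ^ Suc k) *\<^sub>R wfun (Suc k) (\<omega> * t))"
        unfolding eq by (rule summable_scaleR_right[OF sg])
      then have "summable (\<lambda>k. (1 / \<omega> ^ k) *\<^sub>R wfun k (\<omega> * t))" by (rule summable_Suc_iff[THEN iffD1])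
      from suminf_split_head[OF this] have "(\<Sum>k. (1 / \<omega> ^ k) *\<^sub>R wfun k (\<omega> * t))
          = wfun 0 (\<omega> * t) + (1 / \<omega>) *\<^sub>R (\<Sum>k. g k t)"
        unfolding eq suminf_scaleR_right[OF sg] by simp
      moreover have "wfun 0 (\<omega> * t) = cvec 0" by (simp add: wfun_eq trig_def ycoef_0)
      ultimately show ?thesis using pos by (simp add: solution_def scaleR_add_right)
    qed
    have "Z = ?X" if Z: "is_periodic_solution m A0 B d \<omega> Z" for Z
    proof
      fix t
      have "(\<lambda>t. Z t - ?X t) t = 0"
      proof (rule \<Omega>[rule_format, OF \<omega>(2), where v = "\<lambda>t. Z t - ?X t"])
        fix t
        interpret osc: bounded_linear "osc_op m B (\<omega> * t)" by (rule bounded_linear_osc_op)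
        have "((\<lambda>t. Z t - ?X t) has_vector_derivative
            osc_rhs m A0 B d \<omega> t (Z t) - osc_rhs m A0 B d \<omega> t (?X t)) (at t)"
          using X Z by (intro has_vector_derivative_diff) (auto simp: is_periodic_solution_def)
        then show "((\<lambda>t. Z t - ?X t) has_vector_derivative A0 *v (Z t - ?X t)
            + (1 / \<omega>) *\<^sub>R (B 0 *v (Z t - ?X t)) + osc_op m B (\<omega> * t) (Z t - ?X t)) (at t)"
          by (simp add: osc_rhs_eq vec.diff osc.diff scaleR_diff_right algebra_simps)
        show "Z (t + 2 * pi / \<omega>) - ?X (t + 2 * pi / \<omega>) = Z t - ?X t"
          using X Z by (simp add: is_periodic_solution_def)
      qed
      then show "Z t = ?X t" by simp
    qed
    moreover have "uniform_limit UNIV (\<lambda>N t. \<omega> *\<^sub>R cvec 0 + (\<Sum>k<N. g k t)) ?X sequentially"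
      unfolding X_eq[abs_def] by (intro uniform_limit_add uniform_limit_const tail(2))
    moreover have "norm (?X t - \<omega> *\<^sub>R cvec 0 - (\<Sum>k=0..r. g k t)) \<le> M0 ^ (r + 1) / \<omega> ^ (r + 1)" for t r
    proof -
      have "norm (?X t - \<omega> *\<^sub>R cvec 0 - (\<Sum>k=0..r. g k t)) \<le> 2 * (C * S) * (S / \<omega>) ^ (r + 1)"
        using tail(3)[of t r] by (simp add: X_eq)
      also have "\<dots> \<le> max 1 (2 * (C * S)) ^ (r + 1) * (S / \<omega>) ^ (r + 1)"
      proof (rule mult_right_mono)
        have "max 1 (2 * (C * S)) ^ 1 \<le> max 1 (2 * (C * S)) ^ (r + 1)"
          by (intro power_increasing) auto
        then show "2 * (C * S) \<le> max 1 (2 * (C * S)) ^ (r + 1)" by simp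
      qed (rule zero_le_power[OF q(1)])
      finally show ?thesis by (simp only: M0_def power_mult_distrib power_divide times_divide_eq_right)
    qed
    ultimately show ?thesis using X tail(1) unfolding g_def by blast
  qed
  show ?thesis
    by (intro exI[of _ M0] eventually_mono[OF eventually_gt_at_top[of "max (2 * S) \<Omega>"]] main) auto
qed

end

theorem mainTheorem1:
  fixes m s :: nat
  assumes "1 \<le> s" "s \<le> CARD('n::finite)"
  shows
    "\<exists>(Cm_of :: nat \<Rightarrow> 'n data \<Rightarrow> complex) (C_of :: nat \<Rightarrow> nat \<Rightarrow> 'n data \<Rightarrow> complex)
      (x_of :: nat \<Rightarrow> 'n data \<Rightarrow> complex ^ 'n) (y_of :: nat \<Rightarrow> 'n data \<Rightarrow> real \<Rightarrow> complex ^ 'n).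
      (\<forall>j\<in>{1..s}. Cm_of j \<in> arith_num m s) \<and>
      (\<forall>k. \<forall>j\<in>{1..s}. C_of k j \<in> arith_num m s) \<and>
      (\<forall>k p. (\<lambda>D. x_of k D $ p) \<in> arith_num m s) \<and>
      (\<forall>k p. (\<lambda>D \<tau>. y_of k D \<tau> $ p) \<in> arith_fun m s) \<and>
      (\<forall>(A0 :: complex ^ 'n ^ 'n) (B :: int \<Rightarrow> complex ^ 'n ^ 'n)
        (d :: int \<Rightarrow> complex ^ 'n) (a :: nat \<Rightarrow> complex ^ 'n).
        is_eigenvalue A0 0 \<longrightarrow>
        is_kernel_basis s a A0 \<longrightarrow>
        (\<forall>\<mu> :: nat \<Rightarrow> complex. (\<exists>j\<in>{1..s}. \<mu> j \<noteq> 0) \<longrightarrow>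
          \<not> (\<exists>x. A0 *v x + averaged_A1 m B *v (\<Sum>j=1..s. \<mu> j *s a j) = 0)) \<longrightarrow>
        (let D = (A0, B, d, a);
             Cm = (\<lambda>j. Cm_of j D); C = (\<lambda>k j. C_of k j D);
             x = (\<lambda>k. x_of k D); y = (\<lambda>k. y_of k D);
             lead = (\<lambda>\<omega> :: real. \<omega> *\<^sub>R (\<Sum>j=1..s. Cm j *s a j))
         in
          (\<forall>k. continuous_on UNIV (y k) \<and> (\<forall>\<tau>. y k (\<tau> + 2 * pi) = y k \<tau>)
               \<and> mean (2 * pi) (y k) = 0) \<and>
          (\<exists>M0 :: real. \<forall>\<^sub>F \<omega> in at_top.
            \<exists>X. is_periodic_solution m A0 B d \<omega> X \<and>
                (\<forall>Z. is_periodic_solution m A0 B d \<omega> Z \<longrightarrow> Z = X) \<and>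
                (\<forall>t. summable (\<lambda>k. norm (series_term s a C x y \<omega> k t))) \<and>
                uniform_limit UNIV
                  (\<lambda>N t. lead \<omega> + (\<Sum>k<N. series_term s a C x y \<omega> k t)) X sequentially \<and>
                (\<forall>t r. norm (X t - lead \<omega> - (\<Sum>k=0..r. series_term s a C x y \<omega> k t))
                        \<le> M0 ^ (r + 1) / \<omega> ^ (r + 1)))))"
proof -
  obtain P :: "'n data \<Rightarrow> complex ^ 'n ^ 'n" and G :: "nat \<Rightarrow> 'n data \<Rightarrow> complex ^ 'n"
    where PG: "right_inverse_procedure m s P G"
    using right_inverse_procedure_exists by blast
  then have P: "arith_mat m s P" and G: "\<And>j. j \<in> {1..s} \<Longrightarrow> arith_vec m s (G j)"
    by (simp_all add: right_inverse_procedure_def)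
  let ?f = "\<lambda>D. averaged_recursion.fvec m s (data_A0 D) (data_B D) (data_d D) (data_a D)
      (P D) (\<lambda>j. G j D)"
  let ?p = "\<lambda>D. averaged_recursion.pvec m s (data_A0 D) (data_B D) (data_d D) (data_a D)
      (P D) (\<lambda>j. G j D)"
  let ?y = "\<lambda>D. averaged_recursion.ycoef m s (data_A0 D) (data_B D) (data_d D) (data_a D)
      (P D) (\<lambda>j. G j D)"
  define Cm_of where "Cm_of = (\<lambda>j D. row_apply (G j D) (?f D 0))"
  define C_of where "C_of = (\<lambda>k j D. row_apply (G j D) (?f D (Suc k)))"
  define x_of where "x_of = (\<lambda>k D. ?p D (Suc k))"
  define y_of where "y_of = (\<lambda>k D. trig (m * Suc k) (?y D (Suc k)))"
  note arith = arith_averaged_recursion[OF P G]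
  have "\<forall>j\<in>{1..s}. Cm_of j \<in> arith_num m s" "\<forall>k. \<forall>j\<in>{1..s}. C_of k j \<in> arith_num m s"
    unfolding Cm_of_def C_of_def by (intro allI ballI arith_row_apply G arith(3); assumption)+
  moreover have "\<forall>k p. (\<lambda>D. x_of k D $ p) \<in> arith_num m s"
    unfolding x_of_def by (intro allI arith(2)[unfolded arith_vec_def, rule_format])
  moreover have "\<forall>k p. (\<lambda>D \<tau>. y_of k D \<tau> $ p) \<in> arith_fun m s"
    unfolding y_of_def by (intro allI arith_fun_trig arith(1))
  moreover have "(\<forall>k. continuous_on UNIV (y_of k D) \<and> (\<forall>\<tau>. y_of k D (\<tau> + 2 * pi) = y_of k D \<tau>)
          \<and> mean (2 * pi) (y_of k D) = 0)" for D
    unfolding y_of_def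
    by (simp add: trig_continuous trig_periodic trig_mean averaged_recursion.ycoef_mean)
  moreover have "\<exists>M0. \<forall>\<^sub>F \<omega> in at_top. \<exists>X. is_periodic_solution m A0 B d \<omega> X \<and>
      (\<forall>Z. is_periodic_solution m A0 B d \<omega> Z \<longrightarrow> Z = X) \<and>
      (\<forall>t. summable (\<lambda>k. norm (series_term s a (\<lambda>k j. C_of k j (A0, B, d, a))
        (\<lambda>k. x_of k (A0, B, d, a)) (\<lambda>k. y_of k (A0, B, d, a)) \<omega> k t))) \<and>
      uniform_limit UNIV
        (\<lambda>N t. \<omega> *\<^sub>R (\<Sum>j=1..s. Cm_of j (A0, B, d, a) *s a j)
          + (\<Sum>k<N. series_term s a (\<lambda>k j. C_of k j (A0, B, d, a))
        (\<lambda>k. x_of k (A0, B, d, a)) (\<lambda>k. y_of k (A0, B, d, a)) \<omega> k t)) X sequentially \<and>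
      (\<forall>t r. norm (X t - \<omega> *\<^sub>R (\<Sum>j=1..s. Cm_of j (A0, B, d, a) *s a j)
          - (\<Sum>k=0..r. series_term s a (\<lambda>k j. C_of k j (A0, B, d, a))
        (\<lambda>k. x_of k (A0, B, d, a)) (\<lambda>k. y_of k (A0, B, d, a)) \<omega> k t))
                \<le> M0 ^ (r + 1) / \<omega> ^ (r + 1))"
    if ker: "is_kernel_basis s a A0"
      and nosol: "\<forall>\<mu> :: nat \<Rightarrow> complex. (\<exists>j\<in>{1..s}. \<mu> j \<noteq> 0) \<longrightarrow>
          \<not> (\<exists>x. A0 *v x + averaged_A1 m B *v (\<Sum>j=1..s. \<mu> j *s a j) = 0)"
    for A0 B d a
  proof -
    let ?D = "(A0, B, d, a)"
    have "right_inverse_at m s ?D (P ?D) (\<lambda>j. G j ?D)"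
      using PG averaged_system_surjective[OF ker] nosol
      by (simp add: right_inverse_procedure_def)
    then have ri: "A0 *v (P ?D *v g) + averaged_A1 m B *v
        averaged_recursion.kernel_part s a (\<lambda>j. G j ?D) g = g" for g
      by (simp add: right_inverse_at_def averaged_recursion.kernel_part_def)
    interpret averaged_system m s A0 B d a "P ?D" "\<lambda>j. G j ?D"
      by unfold_locales
         (use ri kernel_sum_in[OF ker] in \<open>simp_all add: averaged_recursion.kernel_part_def\<close>)
    have "cvec 0 = (\<Sum>j=1..s. Cm_of j ?D *s a j)"
      by (simp add: cvec_def pvec_0 kernel_part_def Cm_of_def)
    moreover have "(1 / \<omega> ^ k) *\<^sub>R wfun (Suc k) (\<omega> * t) = series_term s a (\<lambda>k j. C_of k j ?D)
        (\<lambda>k. x_of k ?D) (\<lambda>k. y_of k ?D) \<omega> k t" for \<omega> k t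
      by (simp add: series_term_def wfun_eq cvec_def kernel_part_def C_of_def x_of_def y_of_def
          add_ac)
    ultimately show ?thesis using periodic_solution_expansion by simp
  qed
  ultimately show ?thesis
    unfolding Let_def by (intro exI[of _ Cm_of] exI[of _ C_of] exI[of _ x_of] exI[of _ y_of]) blast
qed

end
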